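(* Let $\mathcal A$ be a unital operator algebra and $\mathfrak A$ a C$^*$-cover of $\mathcal A$ such that $\mathcal A$ is Dirichlet in $\mathfrak A$. Suppose that $\mathcal A$ contains an abelian $*$-subalgebra $\mathfrak M$ which, under the natural embedding $\mathcal A\to\mathfrak A$, is a Cartan subalgebra of $\mathfrak A$. Let $x_0\in X=\widehat{\mathfrak M}$ be a point with trivial isotropy, and let $\pi_0:\mathfrak A\to\mathcal B(H_0)$ be the irreducible GNS representation of the pure state $\rho_0(a)=E(a)(x_0)$ of $\mathfrak A$, where $E:\mathfrak A\to\mathfrak M=C(X)$ is the faithful conditional expectation. Then the restriction $\pi_0:\mathcal A\to\mathcal B(H_0)$ of $\pi_0$ to $\mathcal A$ is a nest representation.
   Context: A C$^*$-cover of an operator algebra $\mathcal A$ is a C$^*$-algebra $\mathfrak A$ together with a completely isometric (homomorphic) embedding $j:\mathcal A\to\mathfrak A$; one writes $\mathcal A\subset\mathfrak A$. $\mathcal A$ is Dirichlet in $\mathfrak A$ if $\mathcal A+\mathcal A^*$ is norm-dense in $\mathfrak A$. A representation of $\mathcal A$ is a completely contractive homomorphism $\pi:\mathcal A\to\mathcal B(H)$; it is a nest representation if the lattice of invariant subspaces of $\pi(\mathcal A)$ is totally ordered by inclusion. Cartan pairs: all C$^*$-algebras here are unital. $(\mathfrak A,\mathfrak M)$ is a Cartan pair ($\mathfrak M$ is a Cartan subalgebra of $\mathfrak A$) if $\mathfrak A$ is a separable C$^*$-algebra, $\mathfrak M$ is a maximal abelian C$^*$-subalgebra of $\mathfrak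 A$ (containing the unit), $\mathfrak M$ is regular, i.e. the set $\mathcal N$ of normalizers generates $\mathfrak A$ as a C$^*$-algebra, and there is a faithful conditional expectation $E:\mathfrak A\to\mathfrak M$ (it is unique). A normalizer is an element $0\ne n\in\mathfrak A$ with $n^*\mathfrak M n\subset\mathfrak M$ and $n\mathfrak M n^*\subset\mathfrak M$. With $X=\widehat{\mathfrak M}$ the Gelfand space, $\mathfrak M$ is identified with $C(X)$. For $n\in\mathcal N$, $\alpha_n$ denotes the homeomorphism from the open set $\mathrm{dom}(\alpha_n)=\{x\in X: n^*n(x)>0\}$ onto $\{x\in X: nn^*(x)>0\}$ determined by $(n^*hn)(x)=h(\alpha_n(x))\,n^*n(x)$ for $h\in C(X)$. A point $x\in X$ has non-trivial isotropy if there is $n\in\mathcal N$ with $x\in\mathrm{dom}(\alpha_n)$, $\alpha_n(x)=x$ and $E(n)(x)=0$ (equivalently, $\alpha_n(x)=x$ but $\alpha_n$ is not the identity on any neighborhood of $x$); otherwise $x$ has trivial isotropy. *)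

theory Defs
  imports "HOL-Analysis.Analysis"
begin

section \<open>Complex Hilbert spaces and unital C*-algebras\<close>

class scaleC =
  fixes scaleC :: "complex \<Rightarrow> 'a \<Rightarrow> 'a" (infixr "*\<^sub>C" 75)

class complex_normed_vector = real_normed_vector + scaleC +
  assumes scaleC_add_right: "c *\<^sub>C (x + y) = c *\<^sub>C x + c *\<^sub>C y"
    and scaleC_add_left: "(c + d) *\<^sub>C x = c *\<^sub>C x + d *\<^sub>C x"
    and scaleC_scaleC: "c *\<^sub>C (d *\<^sub>C x) = (c * d) *\<^sub>C x"
    and scaleC_of_real: "complex_of_real r *\<^sub>C x = r *\<^sub>R x"
    and norm_scaleC: "norm (c *\<^sub>C x) = cmod c * norm x"

text \<open>The inner product is conjugate linear in the first variable and linear in the second.\<close>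

class complex_hilbert_space = complex_normed_vector + banach +
  fixes cinner :: "'a \<Rightarrow> 'a \<Rightarrow> complex"
  assumes cinner_commute: "cinner x y = cnj (cinner y x)"
    and cinner_add_right: "cinner x (y + z) = cinner x y + cinner x z"
    and cinner_scaleC_right: "cinner x (c *\<^sub>C y) = c * cinner x y"
    and cinner_self: "cinner x x = complex_of_real ((norm x)\<^sup>2)"

class cstar_algebra = complex_normed_vector + real_normed_algebra_1 + banach +
  fixes star :: "'a \<Rightarrow> 'a"
  assumes mult_scaleC_left: "(c *\<^sub>C a) * b = c *\<^sub>C (a * b)"
    and mult_scaleC_right: "a * (c *\<^sub>C b) = c *\<^sub>C (a * b)"
    and star_star: "star (star a) = a"
    and star_add: "star (a + b) = star a + star b"
    and star_scaleC: "star (c *\<^sub>C a) = cnj c *\<^sub>C star a"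
    and star_mult: "star (a * b) = star b * star a"
    and norm_star_mult: "norm (star a * a) = (norm a)\<^sup>2"

instantiation complex :: complex_hilbert_space
begin
definition "scaleC_complex c (z :: complex) = c * z"
definition "cinner_complex w (z :: complex) = cnj w * z"
instance
  by standard
    (auto simp: scaleC_complex_def cinner_complex_def algebra_simps norm_mult scaleR_conv_of_real
      complex_norm_square simp flip: of_real_power)
end

instantiation complex :: cstar_algebra
begin
definition "star_complex = cnj"
instance
  by standard
    (auto simp: scaleC_complex_def star_complex_def norm_mult power2_eq_square)
end

text \<open>Real bounded linear maps into a complex space carry the pointwise complex structure.\<close>

instantiation blinfun :: (real_normed_vector, complex_normed_vector) complex_normed_vector
begin

lift_definition scaleC_blinfun ::
  "complex \<Rightarrow> ('a \<Rightarrow>\<^sub>L 'b) \<Rightarrow> ('a \<Rightarrow>\<^sub>L 'b)" is "\<lambda>c f x. c *\<^sub>C f x"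
proof -
  fix c :: complex and f :: "'a \<Rightarrow> 'b"
  assume f: "bounded_linear f"
  have "bounded_linear (\<lambda>y :: 'b. c *\<^sub>C y)"
    by (rule bounded_linear_intro[where K = "cmod c"])
      (simp_all add: scaleC_add_right norm_scaleC scaleC_scaleC mult.commute
        flip: scaleC_of_real)
  from bounded_linear_compose[OF this f] show "bounded_linear (\<lambda>x. c *\<^sub>C f x)" .
qed

instance
proof
  fix c d :: complex and r :: real and S T :: "'a \<Rightarrow>\<^sub>L 'b"
  show "c *\<^sub>C (S + T) = c *\<^sub>C S + c *\<^sub>C T"
    by transfer (simp add: scaleC_add_right)
  show "(c + d) *\<^sub>C S = c *\<^sub>C S + d *\<^sub>C S"
    by transfer (simp add: scaleC_add_left)
  show "c *\<^sub>C d *\<^sub>C S = (c * d) *\<^sub>C S"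
    by transfer (simp add: scaleC_scaleC)
  show "complex_of_real r *\<^sub>C S = r *\<^sub>R S"
    by transfer (simp add: scaleC_of_real)
  show "norm (c *\<^sub>C S) = cmod c * norm S"
  proof transfer
    fix c :: complex and f :: "'a \<Rightarrow> 'b"
    assume "bounded_linear f"
    then have "onorm (\<lambda>x. cmod c *\<^sub>R f x) = cmod c * onorm f"
      by (simp add: onorm_scaleR)
    then show "onorm (\<lambda>x. c *\<^sub>C f x) = cmod c * onorm f"
      by (simp add: onorm_def norm_scaleC)
  qed
qed

end

definition complex_subspace :: "'a::complex_normed_vector set \<Rightarrow> bool" where
  "complex_subspace V \<longleftrightarrow>
     0 \<in> V \<and> (\<forall>x\<in>V. \<forall>y\<in>V. x + y \<in> V) \<and> (\<forall>c. \<forall>x\<in>V. c *\<^sub>C x \<in> V)"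

definition complex_linear_on ::
  "'a::complex_normed_vector set \<Rightarrow> ('a \<Rightarrow> 'b::complex_normed_vector) \<Rightarrow> bool" where
  "complex_linear_on V f \<longleftrightarrow>
     (\<forall>x\<in>V. \<forall>y\<in>V. f (x + y) = f x + f y) \<and> (\<forall>c. \<forall>x\<in>V. f (c *\<^sub>C x) = c *\<^sub>C f x)"


section \<open>Operators, matrix norms and operator algebras\<close>

text \<open>The algebra \<open>B(H)\<close>; its norm is the operator norm of the type of bounded linear maps.\<close>

definition bounded_ops :: "('h::complex_hilbert_space \<Rightarrow>\<^sub>L 'h) set" where
  "bounded_ops = {T. complex_linear_on UNIV (blinfun_apply T)}"

definition is_adjoint ::
  "('h::complex_hilbert_space \<Rightarrow>\<^sub>L 'h) \<Rightarrow> ('h \<Rightarrow>\<^sub>L 'h) \<Rightarrow> bool" where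
  "is_adjoint T S \<longleftrightarrow> (\<forall>x y. cinner (T x) y = cinner x (S y))"

text \<open>An \<open>n \<times> n\<close> matrix is a function of two indices, of which only the values at indices
  below \<open>n\<close> matter. The matrix norms are suprema in the extended reals, so that they are
  meaningful without a prior proof of finiteness; their values are finite.

  A matrix of operators on \<open>H\<close> is normed as an operator on the direct sum of \<open>n\<close> copies
  of \<open>H\<close>.\<close>

definition op_matrix_norm ::
  "nat \<Rightarrow> (nat \<Rightarrow> nat \<Rightarrow> ('h::complex_hilbert_space \<Rightarrow>\<^sub>L 'h)) \<Rightarrow> ereal" where
  "op_matrix_norm n T =
     (SUP \<xi> \<in> {\<xi> :: nat \<Rightarrow> 'h. (\<Sum>j<n. (norm (\<xi> j))\<^sup>2) \<le> 1}.
        ereal (sqrt (\<Sum>i<n. (norm (\<Sum>j<n. T i j (\<xi> j)))\<^sup>2)))"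

text \<open>The C*-norm of the matrix algebra over a C*-algebra \<open>B\<close>: matrices act by left
  multiplication on the Hilbert module of columns of length \<open>n\<close> over \<open>B\<close>, with
  \<open>B\<close>-valued inner product \<open>\<langle>y, x\<rangle> = \<Sum>i<n. star (y i) * x i\<close> and norm
  \<open>sqrt (norm \<langle>x, x\<rangle>)\<close>. The norm of the matrix is the norm of that operator, that is, the
  supremum of \<open>norm \<langle>y, a x\<rangle>\<close> over \<open>x\<close> and \<open>y\<close> in the unit ball.\<close>

definition cstar_column_ball :: "nat \<Rightarrow> (nat \<Rightarrow> 'a::cstar_algebra) set" where
  "cstar_column_ball n = {x. norm (\<Sum>i<n. star (x i) * x i) \<le> 1}"

definition cstar_matrix_norm ::
  "nat \<Rightarrow> (nat \<Rightarrow> nat \<Rightarrow> 'a::cstar_algebra) \<Rightarrow> ereal" where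
  "cstar_matrix_norm n a =
     (SUP (x, y) \<in> cstar_column_ball n \<times> cstar_column_ball n.
        ereal (norm (\<Sum>i<n. star (y i) * (\<Sum>j<n. a i j * x j))))"

definition unital_operator_algebra :: "('k::complex_hilbert_space \<Rightarrow>\<^sub>L 'k) set \<Rightarrow> bool" where
  "unital_operator_algebra A \<longleftrightarrow>
     A \<subseteq> bounded_ops \<and> complex_subspace A \<and> closed A \<and> id_blinfun \<in> A \<and>
     (\<forall>S\<in>A. \<forall>T\<in>A. S o\<^sub>L T \<in> A)"

definition abelian_star_subalgebra_of ::
  "('k::complex_hilbert_space \<Rightarrow>\<^sub>L 'k) set \<Rightarrow> ('k \<Rightarrow>\<^sub>L 'k) set \<Rightarrow> bool" where
  "abelian_star_subalgebra_of A M \<longleftrightarrow>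
     M \<subseteq> A \<and> complex_subspace M \<and>
     (\<forall>S\<in>M. \<forall>T\<in>M. S o\<^sub>L T \<in> M \<and> S o\<^sub>L T = T o\<^sub>L S) \<and>
     (\<forall>T\<in>M. \<exists>S\<in>M. is_adjoint T S)"

text \<open>A C*-cover: a completely isometric homomorphism into a C*-algebra.\<close>

definition cstar_cover ::
  "('k::complex_hilbert_space \<Rightarrow>\<^sub>L 'k) set \<Rightarrow> (('k \<Rightarrow>\<^sub>L 'k) \<Rightarrow> 'a::cstar_algebra) \<Rightarrow> bool" where
  "cstar_cover A j \<longleftrightarrow>
     complex_linear_on A j \<and>
     (\<forall>S\<in>A. \<forall>T\<in>A. j (S o\<^sub>L T) = j S * j T) \<and>
     (\<forall>n T. (\<forall>p<n. \<forall>q<n. T p q \<in> A) \<longrightarrow>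
        cstar_matrix_norm n (\<lambda>p q. j (T p q)) = op_matrix_norm n T)"

definition dirichlet :: "'a::cstar_algebra set \<Rightarrow> bool" where
  "dirichlet B \<longleftrightarrow> closure {a + star b | a b. a \<in> B \<and> b \<in> B} = UNIV"

definition representation ::
  "('k::complex_hilbert_space \<Rightarrow>\<^sub>L 'k) set \<Rightarrow>
   (('k \<Rightarrow>\<^sub>L 'k) \<Rightarrow> ('h::complex_hilbert_space \<Rightarrow>\<^sub>L 'h)) \<Rightarrow> bool" where
  "representation A \<pi> \<longleftrightarrow>
     \<pi> ` A \<subseteq> bounded_ops \<and> complex_linear_on A \<pi> \<and>
     (\<forall>S\<in>A. \<forall>T\<in>A. \<pi> (S o\<^sub>L T) = \<pi> S o\<^sub>L \<pi> T) \<and>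
     (\<forall>n T. (\<forall>p<n. \<forall>q<n. T p q \<in> A) \<longrightarrow>
        op_matrix_norm n (\<lambda>p q. \<pi> (T p q)) \<le> op_matrix_norm n T)"

definition invariant_subspaces ::
  "('h::complex_hilbert_space \<Rightarrow>\<^sub>L 'h) set \<Rightarrow> 'h set set" where
  "invariant_subspaces B =
     {V. complex_subspace V \<and> closed V \<and> (\<forall>T\<in>B. \<forall>v\<in>V. T v \<in> V)}"

definition nest_representation ::
  "('k::complex_hilbert_space \<Rightarrow>\<^sub>L 'k) set \<Rightarrow>
   (('k \<Rightarrow>\<^sub>L 'k) \<Rightarrow> ('h::complex_hilbert_space \<Rightarrow>\<^sub>L 'h)) \<Rightarrow> bool" where
  "nest_representation A \<pi> \<longleftrightarrow>
     representation A \<pi> \<and>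
     (\<forall>V \<in> invariant_subspaces (\<pi> ` A). \<forall>W \<in> invariant_subspaces (\<pi> ` A). V \<subseteq> W \<or> W \<subseteq> V)"


section \<open>Cartan pairs\<close>

definition cstar_subalgebra :: "'a::cstar_algebra set \<Rightarrow> bool" where
  "cstar_subalgebra B \<longleftrightarrow>
     complex_subspace B \<and> closed B \<and> (\<forall>a\<in>B. \<forall>b\<in>B. a * b \<in> B) \<and> (\<forall>a\<in>B. star a \<in> B)"

definition abelian_cstar_subalgebra :: "'a::cstar_algebra set \<Rightarrow> bool" where
  "abelian_cstar_subalgebra B \<longleftrightarrow> cstar_subalgebra B \<and> (\<forall>a\<in>B. \<forall>b\<in>B. a * b = b * a)"

definition maximal_abelian :: "'a::cstar_algebra set \<Rightarrow> bool" where
  "maximal_abelian M \<longleftrightarrow>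
     abelian_cstar_subalgebra M \<and> (\<forall>B. abelian_cstar_subalgebra B \<and> M \<subseteq> B \<longrightarrow> B = M)"

definition normalizers :: "'a::cstar_algebra set \<Rightarrow> 'a set" where
  "normalizers M = {n. n \<noteq> 0 \<and> (\<forall>m\<in>M. star n * m * n \<in> M) \<and> (\<forall>m\<in>M. n * m * star n \<in> M)}"

text \<open>The positive elements of the C*-algebra \<open>M\<close> are the elements \<open>star b * b\<close> with
  \<open>b \<in> M\<close>.\<close>

definition faithful_conditional_expectation ::
  "'a::cstar_algebra set \<Rightarrow> ('a \<Rightarrow> 'a) \<Rightarrow> bool" where
  "faithful_conditional_expectation M E \<longleftrightarrow>
     complex_linear_on UNIV E \<and>
     range E \<subseteq> M \<and> (\<forall>m\<in>M. E m = m) \<and>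
     (\<forall>a. norm (E a) \<le> norm a) \<and>
     (\<forall>a. \<exists>b\<in>M. E (star a * a) = star b * b) \<and>
     (\<forall>m\<in>M. \<forall>m'\<in>M. \<forall>a. E (m * a * m') = m * E a * m') \<and>
     (\<forall>a. E (star a * a) = 0 \<longrightarrow> a = 0)"

definition cartan_subalgebra :: "'a::cstar_algebra set \<Rightarrow> bool" where
  "cartan_subalgebra M \<longleftrightarrow>
     separable_space (euclidean :: 'a topology) \<and>
     maximal_abelian M \<and> 1 \<in> M \<and>
     cstar_subalgebra hull (normalizers M) = UNIV \<and>
     (\<exists>E. faithful_conditional_expectation M E)"

text \<open>The points of the Gelfand space are the characters of \<open>M\<close>, made unique as functions by
  being extensional. Under \<open>M = C(X)\<close> the value of \<open>h\<close> at the point \<open>x\<close> is \<open>x h\<close>.\<close>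

definition gelfand_space :: "'a::cstar_algebra set \<Rightarrow> ('a \<Rightarrow> complex) set" where
  "gelfand_space M =
     {x \<in> extensional M. complex_linear_on M x \<and>
        (\<forall>a\<in>M. \<forall>b\<in>M. x (a * b) = x a * x b) \<and> (\<exists>a\<in>M. x a \<noteq> 0)}"

text \<open>Below, \<open>0 < z\<close> for a complex number \<open>z\<close> means that \<open>z\<close> is real and positive.\<close>

definition alpha_dom :: "'a::cstar_algebra set \<Rightarrow> 'a \<Rightarrow> ('a \<Rightarrow> complex) set" where
  "alpha_dom M n = {x \<in> gelfand_space M. 0 < x (star n * n)}"

definition alpha :: "'a::cstar_algebra set \<Rightarrow> 'a \<Rightarrow> ('a \<Rightarrow> complex) \<Rightarrow> ('a \<Rightarrow> complex)" where
  "alpha M n x =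
     (THE y. y \<in> gelfand_space M \<and> (\<forall>h\<in>M. x (star n * h * n) = y h * x (star n * n)))"

definition nontrivial_isotropy ::
  "'a::cstar_algebra set \<Rightarrow> ('a \<Rightarrow> 'a) \<Rightarrow> ('a \<Rightarrow> complex) \<Rightarrow> bool" where
  "nontrivial_isotropy M E x \<longleftrightarrow>
     (\<exists>n\<in>normalizers M. x \<in> alpha_dom M n \<and> alpha M n x = x \<and> x (E n) = 0)"


section \<open>GNS representations\<close>

definition star_representation ::
  "('a::cstar_algebra \<Rightarrow> ('h::complex_hilbert_space \<Rightarrow>\<^sub>L 'h)) \<Rightarrow> bool" where
  "star_representation \<pi> \<longleftrightarrow>
     range \<pi> \<subseteq> bounded_ops \<and> complex_linear_on UNIV \<pi> \<and>
     (\<forall>a b. \<pi> (a * b) = \<pi> a o\<^sub>L \<pi> b) \<and> \<pi> 1 = id_blinfun \<and>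
     (\<forall>a. is_adjoint (\<pi> a) (\<pi> (star a)))"

text \<open>The GNS representation of \<open>\<rho>\<close> is determined up to unitary equivalence as the
  *-representation with a cyclic vector \<open>\<Omega>\<close> that implements \<open>\<rho>\<close>.\<close>

definition gns_representation ::
  "('a::cstar_algebra \<Rightarrow> complex) \<Rightarrow>
   ('a \<Rightarrow> ('h::complex_hilbert_space \<Rightarrow>\<^sub>L 'h)) \<Rightarrow> 'h \<Rightarrow> bool" where
  "gns_representation \<rho> \<pi> \<Omega> \<longleftrightarrow>
     star_representation \<pi> \<and>
     closure (range (\<lambda>a. \<pi> a \<Omega>)) = UNIV \<and>
     (\<forall>a. \<rho> a = cinner \<Omega> (\<pi> a \<Omega>))"

end

theory Submission
  imports Defs
begin

text \<open>
  The argument looks at the vectors \<open>\<pi>\<^sub>0(n)\<Omega>\<close> for normalizers \<open>n\<close>. If non-zero, such a vector is a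
  joint eigenvector of \<open>\<MM>\<close>, and the eigenvalues are given by the point \<open>\<alpha>\<^sub>n(x\<^sub>0)\<close> of the orbit of
  \<open>x\<^sub>0\<close> (\<open>orbit_eigenvector\<close>). Trivial isotropy makes orbit vectors over the same point
  proportional: if \<open>n\<close> fixes \<open>x\<^sub>0\<close>, then \<open>E(n)(x\<^sub>0) \<noteq> 0\<close>, and since \<open>n E(n)\<close> commutes
  with \<open>\<MM>\<close> and hence lies in \<open>\<MM>\<close> (\<open>normalizer_mult_expectation_mem\<close>), the vector
  \<open>\<pi>\<^sub>0(n)\<Omega>\<close> is a multiple of \<open>\<Omega>\<close>. Regularity makes the orbit vectors total
  (\<open>orbit_vectors_total\<close>). Thus \<open>H\<^sub>0\<close> is the orthogonal sum of one-dimensional joint eigenspaces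
  of \<open>\<MM>\<close>, one for each point of the orbit.

  A subspace that is invariant under \<open>\<A>\<close> is invariant under \<open>\<MM>\<close>, so it contains each of these
  lines or is orthogonal to it, and it is determined by the lines that it contains. If \<open>V\<close> and \<open>W\<close>
  are invariant and not comparable, take a line \<open>\<complex>\<pi>\<^sub>0(n)\<Omega>\<close> in \<open>V\<close> but not in \<open>W\<close> and a line
  \<open>\<complex>\<pi>\<^sub>0(m)\<Omega>\<close> in \<open>W\<close> but not in \<open>V\<close>. The functional
  \<open>a \<mapsto> \<langle>\<pi>\<^sub>0(m)\<Omega>, \<pi>\<^sub>0(a)\<pi>\<^sub>0(n)\<Omega>\<rangle>\<close> vanishes on \<open>\<A>\<close> because of \<open>V\<close> and on \<open>\<A>\<^sup>*\<close> because
  of \<open>W\<close>, hence everywhere by the Dirichlet property; but \<open>a = m n\<^sup>*\<close> maps \<open>\<pi>\<^sub>0(n)\<Omega>\<close> to a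
  non-zero multiple of \<open>\<pi>\<^sub>0(m)\<Omega>\<close> (\<open>invariant_subspaces_comparable\<close>).

  That \<open>\<pi>\<^sub>0\<close> is completely contractive on \<open>\<A>\<close> is part of the claim. It holds for every
  *-representation with a cyclic vector whose vector functional is bounded
  (\<open>cyclic_representation_completely_contractive\<close>), and is proved without spectral theory: for the
  operator \<open>T\<close> given by a matrix over the C*-algebra, the sequence \<open>\<parallel>(T\<^sup>*T)\<^sup>k\<xi>\<parallel>\<^sup>2\<close> is
  log-convex, so its first ratio is bounded by its rate of growth, which the matrix norm controls.
\<close>

section \<open>Complex Hilbert spaces\<close>

lemma scaleC_minus_one: "(- 1) *\<^sub>C x = - (x :: 'a::complex_normed_vector)"
  using scaleC_of_real[of "- 1" x] by simp

lemma scaleC_one [simp]: "1 *\<^sub>C x = (x :: 'a::complex_normed_vector)"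
  using scaleC_of_real[of 1 x] by simp

lemma scaleC_zero_left [simp]: "0 *\<^sub>C x = (0 :: 'a::complex_normed_vector)"
  using scaleC_of_real[of 0 x] by simp

lemma scaleC_zero_right [simp]: "c *\<^sub>C 0 = (0 :: 'a::complex_normed_vector)"
  using scaleC_add_right[of c 0 "0 :: 'a"] by simp

lemma complex_subspace_diff:
  assumes "complex_subspace V" "x \<in> V" "y \<in> V"
  shows "x - y \<in> V"
  using assms scaleC_minus_one[of y] unfolding complex_subspace_def
  by (metis diff_conv_add_uminus)

lemma scaleC_diff_right: "c *\<^sub>C (x - y) = c *\<^sub>C x - c *\<^sub>C (y :: 'a::complex_normed_vector)"
  using scaleC_add_right[of c "x - y" y] by simp

lemma complex_linear_on_diff:
  assumes "complex_linear_on UNIV f"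
  shows "f (x - y) = f x - f y"
  using assms scaleC_minus_one[of y] scaleC_minus_one[of "f y"] unfolding complex_linear_on_def
  by (metis UNIV_I diff_conv_add_uminus)

lemma complex_linear_on_sum:
  assumes "complex_linear_on UNIV f"
  shows "f (\<Sum>i\<in>I. g i) = (\<Sum>i\<in>I. f (g i))"
proof -
  have "f 0 = 0"
    using complex_linear_on_diff[OF assms, of 0 0] by simp
  then show ?thesis
    using assms unfolding complex_linear_on_def by (induction I rule: infinite_finite_induct) auto
qed

lemma cinner_add_left: "cinner (x + y) z = cinner x z + cinner y (z :: 'h::complex_hilbert_space)"
  by (metis cinner_add_right cinner_commute complex_cnj_add)

lemma cinner_scaleC_left:
  "cinner (c *\<^sub>C x) y = cnj c * cinner x (y :: 'h::complex_hilbert_space)"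
  by (metis cinner_scaleC_right cinner_commute complex_cnj_mult)

lemma cinner_zero_right [simp]: "cinner x (0 :: 'h::complex_hilbert_space) = 0"
  using cinner_scaleC_right[of x 0 0] by simp

lemma cinner_zero_left [simp]: "cinner (0 :: 'h::complex_hilbert_space) x = 0"
  by (subst cinner_commute) simp

lemma cinner_minus_right: "cinner x (- y) = - cinner x (y :: 'h::complex_hilbert_space)"
  using cinner_scaleC_right[of x "- 1" y] by (simp add: scaleC_minus_one)

lemma cinner_diff_right:
  "cinner x (y - z) = cinner x y - cinner x (z :: 'h::complex_hilbert_space)"
  using cinner_add_right[of x y "- z"] by (simp add: cinner_minus_right)

lemma cinner_diff_left:
  "cinner (x - y) z = cinner x z - cinner y (z :: 'h::complex_hilbert_space)"
  by (metis cinner_diff_right cinner_commute complex_cnj_diff)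

lemmas cinner_simps = cinner_add_left cinner_add_right cinner_diff_left cinner_diff_right
  cinner_scaleC_left cinner_scaleC_right

lemma cinner_eq_zero_iff [simp]: "cinner x x = 0 \<longleftrightarrow> x = (0 :: 'h::complex_hilbert_space)"
  by (simp add: cinner_self)

lemma power2_norm_eq_Re_cinner: "(norm x)\<^sup>2 = Re (cinner x (x :: 'h::complex_hilbert_space))"
  by (simp add: cinner_self)

lemma cinner_mult_cinner:
  "cinner x y * cinner y x = complex_of_real ((cmod (cinner x (y :: 'h::complex_hilbert_space)))\<^sup>2)"
  by (metis cinner_commute complex_norm_square)

text \<open>Subtracting from \<open>x\<close> its component along \<open>v\<close> leaves a vector whose square norm is
  the difference of the square norms. This gives the Cauchy--Schwarz inequality, and it
  characterises orthogonality by a minimality property.\<close>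

lemma norm_diff_component:
  fixes v x :: "'h::complex_hilbert_space"
  assumes "v \<noteq> 0"
  shows "(norm (x - (cinner v x / cinner v v) *\<^sub>C v))\<^sup>2 = (norm x)\<^sup>2 - (cmod (cinner v x))\<^sup>2 / (norm v)\<^sup>2"
proof -
  define c where "c = cinner v x / cinner v v"
  have [simp]: "cinner v v \<noteq> 0"
    using assms by simp
  have "cnj c = cinner x v / cinner v v"
    unfolding c_def by (simp flip: cinner_commute)
  then have "cinner (x - c *\<^sub>C v) (x - c *\<^sub>C v)
      = cinner x x - cinner v x * cinner x v / cinner v v"
    by (simp add: cinner_simps c_def field_simps)
  also have "\<dots> = complex_of_real ((norm x)\<^sup>2 - (cmod (cinner v x))\<^sup>2 / (norm v)\<^sup>2)"
    unfolding cinner_mult_cinner by (simp add: cinner_self)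
  finally show ?thesis
    unfolding c_def by (simp only: cinner_self of_real_eq_iff)
qed

lemma cinner_Cauchy_Schwarz:
  "cmod (cinner x y) \<le> norm x * norm (y :: 'h::complex_hilbert_space)"
proof (cases "x = 0")
  case False
  have "0 \<le> (norm (y - (cinner x y / cinner x x) *\<^sub>C x))\<^sup>2"
    by simp
  then have "(cmod (cinner x y))\<^sup>2 \<le> (norm x * norm y)\<^sup>2"
    unfolding norm_diff_component[OF False] using False by (simp add: field_simps)
  then show ?thesis
    by (rule power2_le_imp_le) simp
qed simp

lemma bounded_linear_cinner_right:
  "bounded_linear (\<lambda>y. cinner x (y :: 'h::complex_hilbert_space))"
proof (rule bounded_linear_intro[where K = "norm x"])
  show "cinner x (r *\<^sub>R y) = r *\<^sub>R cinner x y" for r y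
    by (simp add: cinner_scaleC_right scaleR_conv_of_real flip: scaleC_of_real)
  show "norm (cinner x y) \<le> norm y * norm x" for y
    by (metis cinner_Cauchy_Schwarz mult.commute)
qed (simp add: cinner_add_right)

text \<open>Equality in the Cauchy--Schwarz inequality forces proportionality. This recognises
  eigenvectors from scalar products alone.\<close>

lemma eq_scaleC_if_cinner:
  fixes v w :: "'h::complex_hilbert_space"
  assumes "cinner v w = c * cinner v v" and "cinner w w = cnj c * c * cinner v v"
  shows "w = c *\<^sub>C v"
proof -
  have "cinner w v = cnj c * cinner v v"
    by (metis assms(1) cinner_commute complex_cnj_mult)
  then have "cinner (w - c *\<^sub>C v) (w - c *\<^sub>C v) = 0"
    by (simp add: cinner_simps assms algebra_simps)
  then show ?thesis
    by simp
qed

text \<open>The orthogonal projection onto a closed subspace: by the parallelogram law, a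
  sequence in \<open>V\<close> that minimises the distance from \<open>x\<close> is a Cauchy sequence.\<close>

lemma orthogonal_projection_exists:
  fixes V :: "'h::complex_hilbert_space set"
  assumes V: "complex_subspace V" and "closed V"
  obtains p where "p \<in> V" and "\<And>v. v \<in> V \<Longrightarrow> cinner v (x - p) = 0"
proof -
  define d where "d = (INF v\<in>V. (norm (x - v))\<^sup>2)"
  have "V \<noteq> {}"
    using V by (auto simp: complex_subspace_def)
  have bdd: "bdd_below ((\<lambda>v. (norm (x - v))\<^sup>2) ` V)"
    by (rule bdd_belowI2[where m = 0]) simp
  have d_le: "d \<le> (norm (x - v))\<^sup>2" if "v \<in> V" for v
    unfolding d_def by (rule cINF_lower[OF bdd that])
  have "\<exists>v\<in>V. (norm (x - v))\<^sup>2 < d + 1 / Suc k" for k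
    using cINF_less_iff[OF \<open>V \<noteq> {}\<close> bdd, of "d + 1 / Suc k"] by (simp add: d_def)
  then obtain s where s: "\<And>k. s k \<in> V" "\<And>k. (norm (x - s k))\<^sup>2 < d + 1 / Suc k"
    by metis
  \<comment> \<open>The parallelogram law for \<open>x - s k\<close> and \<open>x - s l\<close>; the midpoint of \<open>s k\<close> and \<open>s l\<close> is in
    \<open>V\<close>, so its square distance from \<open>x\<close> is at least \<open>d\<close>.\<close>
  have dist_s: "(norm (s k - s l))\<^sup>2 \<le> 2 / Suc k + 2 / Suc l" for k l
  proof -
    have "(1 / 2) *\<^sub>R (s k + s l) \<in> V"
      using V s(1) unfolding complex_subspace_def by (metis scaleC_of_real)
    from d_le[OF this] have "4 * d \<le> 4 * (norm (x - (1 / 2) *\<^sub>R (s k + s l)))\<^sup>2"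
      by simp
    also have "\<dots> = (norm (2 *\<^sub>R (x - (1 / 2) *\<^sub>R (s k + s l))))\<^sup>2"
      by (simp add: power_mult_distrib)
    also have "\<dots> = (norm ((x - s k) + (x - s l)))\<^sup>2"
      by (simp add: scaleR_diff_right scaleR_2 algebra_simps)
    finally have "4 * d \<le> (norm ((x - s k) + (x - s l)))\<^sup>2" .
    moreover have "(norm ((x - s k) + (x - s l)))\<^sup>2 + (norm ((x - s k) - (x - s l)))\<^sup>2
        = 2 * (norm (x - s k))\<^sup>2 + 2 * (norm (x - s l))\<^sup>2"
      unfolding power2_norm_eq_Re_cinner by (simp add: cinner_simps)
    moreover have "norm ((x - s k) - (x - s l)) = norm (s k - s l)"
      by (simp add: norm_minus_commute)
    ultimately show ?thesis
      using s(2)[of k] s(2)[of l] by simp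
  qed
  have "Cauchy s"
  proof (rule CauchyI)
    fix e :: real assume "e > 0"
    then obtain N where N: "4 / e\<^sup>2 < real N"
      using reals_Archimedean2 by blast
    show "\<exists>N. \<forall>k\<ge>N. \<forall>l\<ge>N. norm (s k - s l) < e"
    proof (intro exI allI impI)
      fix k l assume "k \<ge> N" "l \<ge> N"
      have *: "2 / Suc i < e\<^sup>2 / 2" if "i \<ge> N" for i
      proof -
        have "4 / e\<^sup>2 < Suc i"
          using N that by linarith
        then show ?thesis
          using \<open>e > 0\<close> by (simp add: field_simps)
      qed
      have "(norm (s k - s l))\<^sup>2 < e\<^sup>2"
        using dist_s[of k l] *[OF \<open>k \<ge> N\<close>] *[OF \<open>l \<ge> N\<close>] by linarith
      then show "norm (s k - s l) < e"
        using \<open>e > 0\<close> by (simp add: power_less_imp_less_base)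
    qed
  qed
  then obtain p where p: "s \<longlonglongrightarrow> p"
    using Cauchy_convergent convergent_def by blast
  have "p \<in> V"
    using closed_sequentially[OF \<open>closed V\<close> _ p] s(1) by blast
  have "(norm (x - p))\<^sup>2 \<le> d"
  proof (rule LIMSEQ_le)
    show "(\<lambda>k. (norm (x - s k))\<^sup>2) \<longlonglongrightarrow> (norm (x - p))\<^sup>2"
      by (intro tendsto_intros p)
    show "(\<lambda>k. d + 1 / Suc k) \<longlonglongrightarrow> d"
      using tendsto_add[OF tendsto_const LIMSEQ_inverse_real_of_nat, of d]
      by (simp add: inverse_eq_divide)
    show "\<exists>N. \<forall>n\<ge>N. (norm (x - s n))\<^sup>2 \<le> d + 1 / Suc n"
      using s(2) by (meson less_imp_le)
  qed
  have "cinner v (x - p) = 0" if "v \<in> V" for v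
  proof (cases "v = 0")
    case False
    define c where "c = cinner v (x - p) / cinner v v"
    have "p + c *\<^sub>C v \<in> V"
      using V \<open>p \<in> V\<close> \<open>v \<in> V\<close> by (simp add: complex_subspace_def)
    then have "(norm (x - p))\<^sup>2 \<le> (norm (x - p - c *\<^sub>C v))\<^sup>2"
      using d_le[of "p + c *\<^sub>C v"] \<open>(norm (x - p))\<^sup>2 \<le> d\<close> unfolding diff_diff_eq by linarith
    then have "(cmod (cinner v (x - p)))\<^sup>2 / (norm v)\<^sup>2 \<le> 0"
      unfolding c_def norm_diff_component[OF False] by simp
    then show ?thesis
      using False by (simp add: divide_le_0_iff)
  qed simp
  with \<open>p \<in> V\<close> show ?thesis
    by (rule that)
qed


section \<open>Algebra in C*-algebras\<close>

lemma star_zero [simp]: "star 0 = (0 :: 'a::cstar_algebra)"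
  using star_scaleC[of 0 "0 :: 'a"] by simp

lemma star_one [simp]: "star 1 = (1 :: 'a::cstar_algebra)"
  by (metis mult.left_neutral mult.right_neutral star_mult star_star)

lemma star_minus: "star (- a) = - star (a :: 'a::cstar_algebra)"
  using star_scaleC[of "- 1" a] by (simp add: scaleC_minus_one)

lemma star_diff: "star (a - b) = star a - star (b :: 'a::cstar_algebra)"
  using star_add[of a "- b"] by (simp add: star_minus)

lemma star_scaleR: "star (r *\<^sub>R a) = r *\<^sub>R star (a :: 'a::cstar_algebra)"
  using star_scaleC[of "complex_of_real r" a] by (simp add: scaleC_of_real)

lemma star_mult_self_eq_zero_iff: "star a * a = 0 \<longleftrightarrow> a = (0 :: 'a::cstar_algebra)"
  using norm_star_mult[of a] by auto

lemma norm_star: "norm (star a) = norm (a :: 'a::cstar_algebra)"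
proof -
  have le: "norm x \<le> norm (star x)" for x :: 'a
  proof (cases "x = 0")
    case False
    have "norm x * norm x \<le> norm (star x) * norm x"
      using norm_star_mult[of x] norm_mult_ineq[of "star x" x] by (simp add: power2_eq_square)
    with False show ?thesis
      by simp
  qed simp
  from le[of a] le[of "star a"] show ?thesis
    by (simp add: star_star)
qed

lemma star_sum: "star (\<Sum>i\<in>I. f i) = (\<Sum>i\<in>I. star (f i :: 'a::cstar_algebra))"
  by (induction I rule: infinite_finite_induct) (simp_all add: star_add)

text \<open>The commutant of a self-adjoint set is a C*-algebra. Hence the double commutant of a
  commuting self-adjoint set is an abelian C*-algebra that contains the set.\<close>

lemma cstar_subalgebra_commutant:
  fixes S :: "'a::cstar_algebra set"
  assumes "\<And>s. s \<in> S \<Longrightarrow> star s \<in> S"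
  shows "cstar_subalgebra {a. \<forall>s\<in>S. a * s = s * a}"
proof -
  have "star a * s = s * star a" if "\<forall>s\<in>S. a * s = s * a" "s \<in> S" for a s
    using that(1)[rule_format, OF assms[OF that(2)]] by (metis star_mult star_star)
  moreover have "closed {a. \<forall>s\<in>S. a * s = s * a}"
  proof -
    have "closed (\<Inter>s\<in>S. {a. a * s = s * a})"
      by (intro closed_INT ballI closed_Collect_eq continuous_intros)
    then show ?thesis
      by (simp add: Collect_ball_eq)
  qed
  ultimately show ?thesis
    unfolding cstar_subalgebra_def complex_subspace_def
    by (auto simp: distrib_left distrib_right mult_scaleC_left mult_scaleC_right)
      (metis mult.assoc)
qed

lemma abelian_cstar_subalgebra_exists:
  fixes S :: "'a::cstar_algebra set"
  assumes star: "\<And>s. s \<in> S \<Longrightarrow> star s \<in> S"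
    and commute: "\<And>s t. s \<in> S \<Longrightarrow> t \<in> S \<Longrightarrow> s * t = t * s"
  obtains B where "abelian_cstar_subalgebra B" and "S \<subseteq> B"
proof -
  define C where "C = {a. \<forall>s\<in>S. a * s = s * a}"
  define B where "B = {a. \<forall>c\<in>C. a * c = c * a}"
  have C: "cstar_subalgebra C"
    unfolding C_def using star by (rule cstar_subalgebra_commutant)
  then have "cstar_subalgebra B"
    unfolding B_def by (intro cstar_subalgebra_commutant) (simp add: cstar_subalgebra_def)
  moreover have "S \<subseteq> C"
    unfolding C_def using commute by auto
  then have "B \<subseteq> C"
    unfolding B_def C_def by blast
  then have "\<forall>a\<in>B. \<forall>b\<in>B. a * b = b * a"
    unfolding B_def by blast
  moreover have "S \<subseteq> B"
    unfolding B_def C_def by auto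
  ultimately show ?thesis
    using that unfolding abelian_cstar_subalgebra_def by blast
qed

text \<open>A maximal abelian C*-subalgebra is its own commutant. The element \<open>a\<close> of the commutant
  need not be normal, so maximality is applied to its real and imaginary parts.\<close>

lemma maximal_abelian_commutant:
  fixes M :: "'a::cstar_algebra set"
  assumes M: "maximal_abelian M" and a: "\<And>m. m \<in> M \<Longrightarrow> a * m = m * a"
  shows "a \<in> M"
proof -
  have sub: "complex_subspace M" and star_M: "\<And>m. m \<in> M \<Longrightarrow> star m \<in> M"
    and comm: "\<And>m k. m \<in> M \<Longrightarrow> k \<in> M \<Longrightarrow> m * k = k * m"
    using M by (auto simp: maximal_abelian_def abelian_cstar_subalgebra_def cstar_subalgebra_def)
  have star_a: "star a * m = m * star a" if "m \<in> M" for m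
    using a[OF star_M[OF that]] by (metis star_mult star_star)
  have selfadjoint: "b \<in> M" if "star b = b" "\<And>m. m \<in> M \<Longrightarrow> b * m = m * b" for b
  proof -
    obtain B where "abelian_cstar_subalgebra B" "insert b M \<subseteq> B"
    proof (rule abelian_cstar_subalgebra_exists[of "insert b M"])
      show "star s \<in> insert b M" if "s \<in> insert b M" for s
        using that \<open>star b = b\<close> star_M by auto
      show "s * t = t * s" if "s \<in> insert b M" "t \<in> insert b M" for s t
        using that \<open>\<And>m. m \<in> M \<Longrightarrow> b * m = m * b\<close> comm by auto
    qed
    with M show ?thesis
      unfolding maximal_abelian_def by blast
  qed
  define b where "b = a + star a"
  define c where "c = \<i> *\<^sub>C (a - star a)"
  have "b \<in> M"
    by (rule selfadjoint) (simp_all add: b_def star_add star_star add.commute distrib_left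
        distrib_right a star_a)
  moreover have "c \<in> M"
  proof (rule selfadjoint)
    have "star c = (- \<i>) *\<^sub>C (- (a - star a))"
      unfolding c_def by (simp add: star_scaleC star_diff star_star)
    also have "\<dots> = (- \<i>) *\<^sub>C (- 1) *\<^sub>C (a - star a)"
      by (simp only: scaleC_minus_one)
    finally show "star c = c"
      unfolding c_def by (simp add: scaleC_scaleC)
  qed (simp add: c_def mult_scaleC_left mult_scaleC_right left_diff_distrib right_diff_distrib
      a star_a)
  ultimately have "(1 / 2) *\<^sub>C b + (- \<i> / 2) *\<^sub>C c \<in> M"
    using sub unfolding complex_subspace_def by blast
  moreover have "(1 / 2) *\<^sub>C b + (- \<i> / 2) *\<^sub>C c = a"
  proof -
    have "(- \<i> / 2) *\<^sub>C c = (1 / 2) *\<^sub>C (a - star a)"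
      unfolding c_def by (simp add: scaleC_scaleC)
    then have "(1 / 2) *\<^sub>C b + (- \<i> / 2) *\<^sub>C c = (1 / 2) *\<^sub>C (a + a)"
      unfolding b_def by (simp flip: scaleC_add_right)
    also have "\<dots> = ((1 / 2) + (1 / 2)) *\<^sub>C a"
      unfolding scaleC_add_right scaleC_add_left ..
    finally show ?thesis
      by simp
  qed
  ultimately show ?thesis
    by simp
qed


section \<open>Cyclic representations are completely contractive\<close>

definition column_inner :: "nat \<Rightarrow> (nat \<Rightarrow> 'a::cstar_algebra) \<Rightarrow> (nat \<Rightarrow> 'a) \<Rightarrow> 'a" where
  "column_inner n y x = (\<Sum>i<n. star (y i) * x i)"

definition matrix_column ::
  "nat \<Rightarrow> (nat \<Rightarrow> nat \<Rightarrow> 'a::cstar_algebra) \<Rightarrow> (nat \<Rightarrow> 'a) \<Rightarrow> nat \<Rightarrow> 'a" where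
  "matrix_column n a x i = (\<Sum>j<n. a i j * x j)"

definition matrix_adjoint ::
  "(nat \<Rightarrow> nat \<Rightarrow> 'a::cstar_algebra) \<Rightarrow> nat \<Rightarrow> nat \<Rightarrow> 'a" where
  "matrix_adjoint a i j = star (a j i)"

lemma column_inner_matrix_adjoint:
  "column_inner n (matrix_column n (matrix_adjoint a) y) x = column_inner n y (matrix_column n a x)"
  unfolding column_inner_def matrix_column_def matrix_adjoint_def
  by (simp add: star_sum star_mult star_star sum_distrib_left sum_distrib_right mult.assoc)
    (rule sum.swap)

lemma matrix_adjoint_adjoint: "matrix_adjoint (matrix_adjoint a) = a"
  by (simp add: matrix_adjoint_def star_star fun_eq_iff)

lemma column_inner_matrix:
  "column_inner n (matrix_column n a y) x = column_inner n y (matrix_column n (matrix_adjoint a) x)"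
  using column_inner_matrix_adjoint[of n "matrix_adjoint a" y x]
  by (simp add: matrix_adjoint_adjoint)

text \<open>The definition of the matrix norm bounds the sesquilinear form on the unit ball. Scaling
  uses positive upper bounds of the column norms in place of the norms, which may vanish.\<close>

lemma norm_column_inner_matrix_le:
  fixes a :: "nat \<Rightarrow> nat \<Rightarrow> 'a::cstar_algebra"
  assumes a: "cstar_matrix_norm n a \<le> ereal D" and pos: "s > 0" "t > 0"
    and x: "norm (column_inner n x x) \<le> s\<^sup>2" and y: "norm (column_inner n y y) \<le> t\<^sup>2"
  shows "norm (column_inner n y (matrix_column n a x)) \<le> D * (s * t)"
proof -
  define x' where "x' i = (1 / s) *\<^sub>R x i" for i
  define y' where "y' i = (1 / t) *\<^sub>R y i" for i
  have scale: "column_inner n (\<lambda>i. r *\<^sub>R z i) (\<lambda>i. r' *\<^sub>R w i) = (r * r') *\<^sub>R column_inner n z w"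
    for r r' and z w :: "nat \<Rightarrow> 'a"
    unfolding column_inner_def by (simp add: star_scaleR scaleR_sum_right mult.commute)
  have "x' \<in> cstar_column_ball n" "y' \<in> cstar_column_ball n"
    using x y pos
    unfolding cstar_column_ball_def mem_Collect_eq column_inner_def[symmetric] x'_def y'_def scale
    by (simp_all add: field_simps power2_eq_square)
  then have "ereal (norm (column_inner n y' (matrix_column n a x'))) \<le> cstar_matrix_norm n a"
    unfolding cstar_matrix_norm_def column_inner_def matrix_column_def
    by (intro SUP_upper2[where i = "(x', y')"]) auto
  then have "norm (column_inner n y' (matrix_column n a x')) \<le> D"
    using a by (metis ereal_less_eq(3) order_trans)
  moreover have "matrix_column n a x' = (\<lambda>i. (1 / s) *\<^sub>R matrix_column n a x i)"
    unfolding matrix_column_def x'_def by (simp add: scaleR_sum_right)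
  ultimately show ?thesis
    using pos unfolding y'_def scale by (simp add: scale field_simps)
qed

text \<open>Inserting \<open>y = a x\<close> into the form turns its bound into a bound of the operator.\<close>

lemma norm_matrix_column_le:
  fixes a :: "nat \<Rightarrow> nat \<Rightarrow> 'a::cstar_algebra"
  assumes a: "cstar_matrix_norm n a \<le> ereal D" and pos: "s > 0" "D > 0"
    and x: "norm (column_inner n x x) \<le> s\<^sup>2"
  defines "z \<equiv> matrix_column n a x"
  shows "norm (column_inner n z z) \<le> (D * s)\<^sup>2"
proof -
  define t where "t = sqrt (norm (column_inner n z z))"
  have t: "t\<^sup>2 = norm (column_inner n z z)" "t \<ge> 0"
    by (simp_all add: t_def)
  have "t \<le> D * s"
  proof (cases "t = 0")
    case False
    then have "t\<^sup>2 \<le> D * (s * t)"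
      using norm_column_inner_matrix_le[OF a \<open>s > 0\<close> _ x, of t z] t by (simp add: z_def)
    with False t(2) show ?thesis
      by (simp add: power2_eq_square)
  qed (use pos in simp)
  then show ?thesis
    using t power_mono by metis
qed

text \<open>The definition of the matrix norm gives the adjoint matrix the same bound, because the
  form \<open>\<langle>y, a z\<rangle>\<close> also determines \<open>\<langle>a\<^sup>* y, z\<rangle>\<close>.\<close>

lemma norm_matrix_adjoint_column_le:
  fixes a :: "nat \<Rightarrow> nat \<Rightarrow> 'a::cstar_algebra"
  assumes a: "cstar_matrix_norm n a \<le> ereal D" and pos: "s > 0" "D > 0"
    and y: "norm (column_inner n y y) \<le> s\<^sup>2"
  defines "z \<equiv> matrix_column n (matrix_adjoint a) y"
  shows "norm (column_inner n z z) \<le> (D * s)\<^sup>2"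
proof -
  define t where "t = sqrt (norm (column_inner n z z))"
  have t: "t\<^sup>2 = norm (column_inner n z z)" "t \<ge> 0"
    by (simp_all add: t_def)
  have "t \<le> D * s"
  proof (cases "t = 0")
    case False
    have "column_inner n z z = column_inner n y (matrix_column n a z)"
      unfolding z_def column_inner_matrix_adjoint ..
    then have "t\<^sup>2 \<le> D * (t * s)"
      using norm_column_inner_matrix_le[OF a _ \<open>s > 0\<close> _ y, of t z] t False by simp
    with False t(2) show ?thesis
      by (simp add: power2_eq_square mult.assoc mult.left_commute)
  qed (use pos in simp)
  then show ?thesis
    using t power_mono by metis
qed

text \<open>The ratios of successive terms of a log-convex sequence increase, so the first of them
  is at most the exponential growth rate of the sequence.\<close>

lemma log_convex_first_ratio_le:
  fixes q :: "nat \<Rightarrow> real"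
  assumes nonneg: "\<And>k. q k \<ge> 0" and convex: "\<And>k. (q (Suc k))\<^sup>2 \<le> q k * q (Suc (Suc k))"
    and growth: "\<And>k. q k \<le> L * R ^ k" and "R > 0"
  shows "q 1 \<le> R * q 0"
proof (rule ccontr)
  assume "\<not> q 1 \<le> R * q 0"
  then have less: "R * q 0 < q 1"
    by simp
  have "q 0 \<noteq> 0"
  proof
    assume "q 0 = 0"
    with convex[of 0] less show False
      by simp
  qed
  with nonneg[of 0] have "q 0 > 0"
    by linarith
  define r where "r = q 1 / q 0"
  have "r > R" "r > 0"
    using less \<open>q 0 > 0\<close> \<open>R > 0\<close> unfolding r_def
    by (simp_all add: field_simps) (use nonneg[of 1] in \<open>smt (verit) mult_pos_pos\<close>)
  have ratio: "q k > 0 \<and> r * q k \<le> q (Suc k)" for k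
  proof (induction k)
    case 0
    then show ?case
      using \<open>q 0 > 0\<close> by (simp add: r_def)
  next
    case (Suc k)
    then have "q (Suc k) > 0"
      using \<open>r > 0\<close> by (meson less_le_trans mult_pos_pos)
    have "(r * q k) * q (Suc k) \<le> q (Suc k) * q (Suc k)"
      using Suc \<open>q (Suc k) > 0\<close> by (intro mult_right_mono) auto
    also have "\<dots> \<le> q k * q (Suc (Suc k))"
      using convex[of k] by (simp add: power2_eq_square)
    finally have "q k * (r * q (Suc k)) \<le> q k * q (Suc (Suc k))"
      by (simp add: algebra_simps)
    with Suc \<open>q (Suc k) > 0\<close> show ?case
      by simp
  qed
  have lower: "q 0 * r ^ k \<le> q k" for k
  proof (induction k)
    case (Suc k)
    then have "r * (q 0 * r ^ k) \<le> r * q k"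
      using \<open>r > 0\<close> by simp
    with ratio[of k] show ?case
      by (simp add: algebra_simps)
  qed simp
  obtain k where k: "L / q 0 < (r / R) ^ k"
    using real_arch_pow[of "r / R" "L / q 0"] \<open>r > R\<close> \<open>R > 0\<close> by auto
  have "q 0 * r ^ k \<le> L * R ^ k"
    using lower[of k] growth[of k] by linarith
  with k \<open>q 0 > 0\<close> \<open>R > 0\<close> show False
    by (simp add: power_divide field_simps)
qed

lemma sum_cinner_Cauchy_Schwarz:
  fixes x y :: "nat \<Rightarrow> 'h::complex_hilbert_space"
  shows "(cmod (\<Sum>i<n. cinner (x i) (y i)))\<^sup>2 \<le> (\<Sum>i<n. (norm (x i))\<^sup>2) * (\<Sum>i<n. (norm (y i))\<^sup>2)"
proof -
  have "cmod (\<Sum>i<n. cinner (x i) (y i)) \<le> (\<Sum>i<n. \<bar>norm (x i)\<bar> * \<bar>norm (y i)\<bar>)"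
    by (rule sum_norm_le) (simp add: cinner_Cauchy_Schwarz)
  also have "\<dots> \<le> L2_set (\<lambda>i. norm (x i)) {..<n} * L2_set (\<lambda>i. norm (y i)) {..<n}"
    by (rule L2_set_mult_ineq)
  finally have "(cmod (\<Sum>i<n. cinner (x i) (y i)))\<^sup>2
      \<le> (L2_set (\<lambda>i. norm (x i)) {..<n} * L2_set (\<lambda>i. norm (y i)) {..<n})\<^sup>2"
    by (rule power_mono) simp
  then show ?thesis
    by (simp add: L2_set_def power_mult_distrib sum_nonneg)
qed

lemma star_representation_cinner:
  assumes "star_representation \<pi>"
  shows "cinner (\<pi> a \<xi>) \<eta> = cinner \<xi> (\<pi> (star a) \<eta>)"
  using assms by (simp add: star_representation_def is_adjoint_def)

lemma star_representation_mult:
  assumes "star_representation \<pi>"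
  shows "\<pi> (a * b) \<xi> = \<pi> a (\<pi> b \<xi>)"
  using assms by (simp add: star_representation_def)

lemma star_representation_sum:
  assumes "star_representation \<pi>"
  shows "\<pi> (\<Sum>i\<in>I. f i) \<xi> = (\<Sum>i\<in>I. \<pi> (f i) \<xi>)"
  using assms complex_linear_on_sum[of \<pi> f I]
  by (simp add: star_representation_def blinfun.sum_left)

lemma sum_cinner_column:
  assumes "star_representation \<pi>"
  shows "(\<Sum>i<n. cinner (\<pi> (y i) \<Omega>) (\<pi> (x i) \<Omega>)) = cinner \<Omega> (\<pi> (column_inner n y x) \<Omega>)"
proof -
  have "cinner \<Omega> (\<pi> (column_inner n y x) \<Omega>) = (\<Sum>i<n. cinner \<Omega> (\<pi> (star (y i) * x i) \<Omega>))"
    unfolding column_inner_def star_representation_sum[OF assms]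
    by (rule linear_sum[OF bounded_linear.linear[OF bounded_linear_cinner_right]])
  then show ?thesis
    by (simp add: star_representation_cinner[OF assms] star_representation_mult[OF assms])
qed

text \<open>For the operator \<open>T\<close> that the matrix \<open>\<pi>(a)\<close> defines and the vector \<open>\<xi>\<close> with entries
  \<open>\<pi>(x\<^sub>i)\<Omega>\<close>, the sequence \<open>q\<^sub>k = \<parallel>(T\<^sup>*T)\<^sup>k\<xi>\<parallel>\<^sup>2\<close> is log-convex and grows no faster than
  \<open>D\<^sup>4\<^sup>k\<close>. The bound \<open>K\<close> of the vector functional enters only as a constant factor and so
  disappears from the result.\<close>

lemma cyclic_matrix_estimate:
  fixes \<pi> :: "'a::cstar_algebra \<Rightarrow> ('h::complex_hilbert_space \<Rightarrow>\<^sub>L 'h)"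
  assumes \<pi>: "star_representation \<pi>"
    and bounded: "\<And>b. cmod (cinner \<Omega> (\<pi> b \<Omega>)) \<le> K * norm b"
    and a: "cstar_matrix_norm n a \<le> ereal D" and "D > 0"
  shows "(\<Sum>i<n. (norm (\<pi> (matrix_column n a x i) \<Omega>))\<^sup>2) \<le> D\<^sup>2 * (\<Sum>i<n. (norm (\<pi> (x i) \<Omega>))\<^sup>2)"
proof -
  define S where "S x = matrix_column n (matrix_adjoint a) (matrix_column n a x)" for x
  define u where "u k = (S ^^ k) x" for k
  define q where "q k = (\<Sum>i<n. (norm (\<pi> (u k i) \<Omega>))\<^sup>2)" for k
  have q: "complex_of_real (\<Sum>i<n. (norm (\<pi> (y i) \<Omega>))\<^sup>2) = cinner \<Omega> (\<pi> (column_inner n y y) \<Omega>)" for y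
    unfolding sum_cinner_column[OF \<pi>, symmetric] by (simp add: cinner_self)
  have S: "column_inner n (S y) x = column_inner n y (S x)" for x y
    unfolding S_def column_inner_matrix matrix_adjoint_adjoint ..
  have u_Suc: "u (Suc k) = S (u k)" for k
    unfolding u_def by simp
  obtain s where s: "s > 0" "norm (column_inner n x x) \<le> s\<^sup>2"
  proof
    show "sqrt (norm (column_inner n x x) + 1) > 0"
      by (simp add: add_nonneg_pos)
    show "norm (column_inner n x x) \<le> (sqrt (norm (column_inner n x x) + 1))\<^sup>2"
      by simp
  qed
  have u_norm: "norm (column_inner n (u k) (u k)) \<le> (D ^ (2 * k) * s)\<^sup>2" for k
  proof (induction k)
    case (Suc k)
    have "norm (column_inner n (u (Suc k)) (u (Suc k))) \<le> (D * (D * (D ^ (2 * k) * s)))\<^sup>2"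
      unfolding u_Suc S_def using \<open>D > 0\<close> \<open>s > 0\<close>
      by (intro norm_matrix_adjoint_column_le norm_matrix_column_le a Suc.IH) simp_all
    then show ?case
      by (simp add: mult.assoc)
  qed (use s in \<open>simp add: u_def\<close>)
  have "K \<ge> 0"
    using order_trans[OF norm_ge_zero bounded[of 1]] by simp
  have growth: "q k \<le> (K * s\<^sup>2) * (D ^ 4) ^ k" for k
  proof -
    have "q k = cmod (cinner \<Omega> (\<pi> (column_inner n (u k) (u k)) \<Omega>))"
      unfolding q[symmetric] q_def norm_of_real by (simp add: sum_nonneg)
    also have "\<dots> \<le> K * norm (column_inner n (u k) (u k))"
      by (rule bounded)
    also have "\<dots> \<le> K * (D ^ (2 * k) * s)\<^sup>2"
      using u_norm[of k] \<open>K \<ge> 0\<close> by (rule mult_left_mono)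
    also have "\<dots> = (K * s\<^sup>2) * (D ^ 4) ^ k"
      by (simp add: power_mult_distrib power_mult[symmetric] mult.commute mult.left_commute)
    finally show ?thesis .
  qed
  have convex: "(q (Suc k))\<^sup>2 \<le> q k * q (Suc (Suc k))" for k
  proof -
    have "complex_of_real (q (Suc k)) = (\<Sum>i<n. cinner (\<pi> (u k i) \<Omega>) (\<pi> (u (Suc (Suc k)) i) \<Omega>))"
      unfolding q_def q sum_cinner_column[OF \<pi>] u_Suc S ..
    then have "cmod (\<Sum>i<n. cinner (\<pi> (u k i) \<Omega>) (\<pi> (u (Suc (Suc k)) i) \<Omega>)) = \<bar>q (Suc k)\<bar>"
      by (metis norm_of_real)
    then show ?thesis
      using sum_cinner_Cauchy_Schwarz[of "\<lambda>i. \<pi> (u k i) \<Omega>" "\<lambda>i. \<pi> (u (Suc (Suc k)) i) \<Omega>" n]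
      by (simp add: q_def)
  qed
  have "q 1 \<le> D ^ 4 * q 0"
    using \<open>D > 0\<close> by (intro log_convex_first_ratio_le[OF _ convex growth])
      (simp_all add: q_def sum_nonneg)
  \<comment> \<open>One more Cauchy--Schwarz inequality, \<open>\<parallel>T\<xi>\<parallel>\<^sup>2 = \<langle>\<xi>, T\<^sup>*T\<xi>\<rangle> \<le> \<parallel>\<xi>\<parallel> \<parallel>T\<^sup>*T\<xi>\<parallel>\<close>.\<close>
  define p where "p = (\<Sum>i<n. (norm (\<pi> (matrix_column n a x i) \<Omega>))\<^sup>2)"
  have "complex_of_real p = (\<Sum>i<n. cinner (\<pi> (u 0 i) \<Omega>) (\<pi> (u 1 i) \<Omega>))"
    unfolding p_def q sum_cinner_column[OF \<pi>] column_inner_matrix by (simp add: u_def S_def)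
  then have "cmod (\<Sum>i<n. cinner (\<pi> (u 0 i) \<Omega>) (\<pi> (u 1 i) \<Omega>)) = \<bar>p\<bar>"
    by (metis norm_of_real)
  then have "p\<^sup>2 \<le> q 0 * q 1"
    using sum_cinner_Cauchy_Schwarz[of "\<lambda>i. \<pi> (u 0 i) \<Omega>" "\<lambda>i. \<pi> (u 1 i) \<Omega>" n]
    by (simp add: q_def)
  also have "\<dots> \<le> q 0 * (D ^ 4 * q 0)"
    using \<open>q 1 \<le> D ^ 4 * q 0\<close> by (intro mult_left_mono) (simp_all add: q_def sum_nonneg)
  also have "\<dots> = (D\<^sup>2 * q 0)\<^sup>2"
    by (simp add: power_mult_distrib power2_eq_square power4_eq_xxxx mult.assoc mult.left_commute)
  finally have "p \<le> D\<^sup>2 * q 0"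
    by (rule power2_le_imp_le) (simp add: q_def sum_nonneg)
  then show ?thesis
    unfolding p_def q_def u_def by simp
qed

text \<open>Vectors \<open>\<pi>(x)\<Omega>\<close> are dense, so the estimate extends to all vectors. It is applied with
  real bounds \<open>D > C\<close> because it needs \<open>D > 0\<close>, while the norm of the matrix may vanish.\<close>

theorem cyclic_representation_completely_contractive:
  fixes \<pi> :: "'a::cstar_algebra \<Rightarrow> ('h::complex_hilbert_space \<Rightarrow>\<^sub>L 'h)"
  assumes \<pi>: "star_representation \<pi>"
    and cyclic: "closure (range (\<lambda>a. \<pi> a \<Omega>)) = UNIV"
    and bounded: "\<And>b. cmod (cinner \<Omega> (\<pi> b \<Omega>)) \<le> K * norm b"
  shows "op_matrix_norm n (\<lambda>i j. \<pi> (a i j)) \<le> cstar_matrix_norm n a"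
proof (rule ereal_le_real)
  fix C assume C: "cstar_matrix_norm n a \<le> ereal C"
  have "(\<lambda>_. 0 :: 'a) \<in> cstar_column_ball n"
    by (simp add: cstar_column_ball_def)
  then have "0 \<le> cstar_matrix_norm n a"
    unfolding cstar_matrix_norm_def by (intro SUP_upper2[where i = "(\<lambda>_. 0, \<lambda>_. 0)"]) auto
  then have "C \<ge> 0"
    using C by (metis ereal_less_eq(5) order_trans)
  have "sqrt (\<Sum>i<n. (norm (\<Sum>j<n. \<pi> (a i j) (\<xi> j)))\<^sup>2) \<le> C"
    if \<xi>: "(\<Sum>j<n. (norm (\<xi> j))\<^sup>2) \<le> 1" for \<xi>
  proof (rule dense_ge)
    fix D assume "C < D"
    then have "D > 0" and D: "cstar_matrix_norm n a \<le> ereal D"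
      using \<open>C \<ge> 0\<close> C by (auto intro: order_trans)
    have "\<exists>f. (\<forall>k. f k \<in> range (\<lambda>a. \<pi> a \<Omega>)) \<and> f \<longlonglongrightarrow> \<xi> j" for j
      using cyclic closure_sequential by blast
    then obtain f where f: "\<And>j k. f j k \<in> range (\<lambda>a. \<pi> a \<Omega>)" "\<And>j. f j \<longlonglongrightarrow> \<xi> j"
      by metis
    have "\<forall>k j. \<exists>b. f j k = \<pi> b \<Omega>"
      using f(1) by blast
    then obtain x where x: "\<And>j k. f j k = \<pi> (x k j) \<Omega>"
      by metis
    have "(\<Sum>i<n. (norm (\<Sum>j<n. \<pi> (a i j) (\<xi> j)))\<^sup>2) \<le> D\<^sup>2 * (\<Sum>j<n. (norm (\<xi> j))\<^sup>2)"
    proof (rule LIMSEQ_le)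
      show "(\<lambda>k. \<Sum>i<n. (norm (\<Sum>j<n. \<pi> (a i j) (f j k)))\<^sup>2)
          \<longlonglongrightarrow> (\<Sum>i<n. (norm (\<Sum>j<n. \<pi> (a i j) (\<xi> j)))\<^sup>2)"
        by (intro tendsto_intros f)
      show "(\<lambda>k. D\<^sup>2 * (\<Sum>j<n. (norm (f j k))\<^sup>2)) \<longlonglongrightarrow> D\<^sup>2 * (\<Sum>j<n. (norm (\<xi> j))\<^sup>2)"
        by (intro tendsto_intros f)
      have "(\<Sum>i<n. (norm (\<Sum>j<n. \<pi> (a i j) (f j k)))\<^sup>2) \<le> D\<^sup>2 * (\<Sum>j<n. (norm (f j k))\<^sup>2)" for k
        using cyclic_matrix_estimate[OF \<pi> bounded D \<open>D > 0\<close>, of "x k"]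
        by (simp add: x matrix_column_def star_representation_sum[OF \<pi>] star_representation_mult[OF \<pi>])
      then show "\<exists>N. \<forall>k\<ge>N. (\<Sum>i<n. (norm (\<Sum>j<n. \<pi> (a i j) (f j k)))\<^sup>2)
          \<le> D\<^sup>2 * (\<Sum>j<n. (norm (f j k))\<^sup>2)"
        by blast
    qed
    also have "\<dots> \<le> D\<^sup>2"
      using mult_left_mono[OF \<xi>, of "D\<^sup>2"] by simp
    finally show "sqrt (\<Sum>i<n. (norm (\<Sum>j<n. \<pi> (a i j) (\<xi> j)))\<^sup>2) \<le> D"
      using \<open>D > 0\<close> by (simp add: real_le_lsqrt sum_nonneg)
  qed
  then show "op_matrix_norm n (\<lambda>i j. \<pi> (a i j)) \<le> ereal C"
    unfolding op_matrix_norm_def by (intro SUP_least) simp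
qed

lemma cyclic_representation_norm_le:
  fixes \<pi> :: "'a::cstar_algebra \<Rightarrow> ('h::complex_hilbert_space \<Rightarrow>\<^sub>L 'h)"
  assumes \<pi>: "star_representation \<pi>"
    and cyclic: "closure (range (\<lambda>a. \<pi> a \<Omega>)) = UNIV"
    and bounded: "\<And>b. cmod (cinner \<Omega> (\<pi> b \<Omega>)) \<le> K * norm b"
  shows "norm (\<pi> a \<xi>) \<le> norm a * norm \<xi>"
proof (cases "\<xi> = 0")
  case False
  have "cstar_matrix_norm 1 (\<lambda>i j. a) \<le> ereal (norm a)"
    unfolding cstar_matrix_norm_def
  proof (rule SUP_least, clarify)
    fix x y :: "nat \<Rightarrow> 'a"
    assume "x \<in> cstar_column_ball 1" "y \<in> cstar_column_ball 1"
    then have "norm (x 0) \<le> 1" "norm (star (y 0)) \<le> 1"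
      by (simp_all add: cstar_column_ball_def norm_star_mult norm_star power_le_one_iff)
    then have "norm (star (y 0)) * (norm a * norm (x 0)) \<le> 1 * (norm a * 1)"
      by (intro mult_mono) auto
    then have "norm (star (y 0) * (a * x 0)) \<le> norm a"
      using norm_mult_ineq[of "star (y 0)" "a * x 0"] norm_mult_ineq[of a "x 0"]
        mult_left_mono[OF norm_mult_ineq[of a "x 0"] norm_ge_zero[of "star (y 0)"]] by linarith
    then show "ereal (norm (\<Sum>i<1. star (y i) * (\<Sum>j<1. a * x j))) \<le> ereal (norm a)"
      by simp
  qed
  with cyclic_representation_completely_contractive[OF \<pi> cyclic bounded, of 1 "\<lambda>i j. a"]
  have "op_matrix_norm 1 (\<lambda>i j. \<pi> a) \<le> ereal (norm a)"
    by (rule order_trans)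
  define \<zeta> where "\<zeta> = (1 / norm \<xi>) *\<^sub>R \<xi>"
  have "ereal (sqrt (\<Sum>i<1::nat. (norm (\<Sum>j<1::nat. \<pi> a \<zeta>))\<^sup>2)) \<le> op_matrix_norm 1 (\<lambda>i j. \<pi> a)"
    unfolding op_matrix_norm_def using False by (intro SUP_upper) (simp add: \<zeta>_def)
  then have "norm (\<pi> a \<zeta>) \<le> norm a"
    using \<open>op_matrix_norm 1 (\<lambda>i j. \<pi> a) \<le> ereal (norm a)\<close> order_trans by fastforce
  then show ?thesis
    using False by (simp add: \<zeta>_def blinfun.scaleR_right field_simps)
qed simp


section \<open>Normalizers of a maximal abelian subalgebra\<close>

text \<open>If \<open>g \<in> M\<close> had \<open>x g = 1\<close> and \<open>norm g < 1\<close>, the Neumann series \<open>k\<close> of \<open>g\<close> would be an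
  element of \<open>M\<close> with \<open>k = 1 + g k\<close>, and applying \<open>x\<close> would give \<open>x 1 = 0\<close>.\<close>

lemma character_norm_le:
  fixes M :: "'a::cstar_algebra set"
  assumes M: "cstar_subalgebra M" "1 \<in> M" and x: "x \<in> gelfand_space M" and h: "h \<in> M"
  shows "cmod (x h) \<le> norm h"
proof (rule ccontr)
  have add: "x (a + b) = x a + x b" and scale: "x (c *\<^sub>C a) = c * x a" and mult: "x (a * b) = x a * x b"
    if "a \<in> M" "b \<in> M" for a b c
    using x that by (auto simp: gelfand_space_def complex_linear_on_def scaleC_complex_def)
  assume "\<not> cmod (x h) \<le> norm h"
  then have less: "norm h < cmod (x h)"
    by simp
  define g where "g = (1 / x h) *\<^sub>C h"
  have "x h \<noteq> 0"
    using less norm_ge_zero[of h] by auto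
  then have "norm g < 1"
    using less by (simp add: g_def norm_scaleC norm_divide field_simps)
  have "g \<in> M"
    using M(1) h by (simp add: g_def cstar_subalgebra_def complex_subspace_def)
  have "x g = 1"
    using scale[OF h h] \<open>x h \<noteq> 0\<close> by (simp add: g_def)
  define k where "k = (\<Sum>n. g ^ n)"
  have summable: "summable (\<lambda>n. g ^ n)"
    using \<open>norm g < 1\<close> by (rule complete_algebra_summable_geometric)
  have "g ^ n \<in> M" for n
    by (induction n) (use M \<open>g \<in> M\<close> in \<open>auto simp: cstar_subalgebra_def\<close>)
  then have "(\<Sum>i<n. g ^ i) \<in> M" for n
    by (induction n) (use M in \<open>auto simp: cstar_subalgebra_def complex_subspace_def\<close>)
  then have "k \<in> M"
    using closed_sequentially[of M "\<lambda>n. \<Sum>i<n. g ^ i" k] M(1) summable_LIMSEQ[OF summable]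
    by (simp add: k_def cstar_subalgebra_def)
  have "k = 1 + g * k"
    using suminf_split_head[OF summable] suminf_mult[OF summable, of g] by (simp add: k_def algebra_simps)
  moreover have "g * k \<in> M"
    using M(1) \<open>g \<in> M\<close> \<open>k \<in> M\<close> by (simp add: cstar_subalgebra_def)
  ultimately have "x k = x 1 + x g * x k"
    using add mult M(2) \<open>g \<in> M\<close> \<open>k \<in> M\<close> by metis
  then have "x 1 = 0"
    by (simp add: \<open>x g = 1\<close>)
  then have "x a = 0" if "a \<in> M" for a
    using mult[OF M(2) that] by simp
  with \<open>x h \<noteq> 0\<close> h show False
    by simp
qed

lemma normalizers_mult:
  assumes "n \<in> normalizers M" "m \<in> normalizers M" "n * m \<noteq> 0"
  shows "n * m \<in> normalizers M"
  using assms unfolding normalizers_def by (auto simp: star_mult) (metis mult.assoc)+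

lemma normalizers_star: "n \<in> normalizers M \<Longrightarrow> star n \<in> normalizers M"
  unfolding normalizers_def by (auto simp: star_star) (metis star_star star_zero)+

text \<open>An algebraic form of the fact that \<open>\<alpha>\<^sub>n\<close> is the identity on the open support of
  \<open>e = E n\<close>. Applying \<open>E\<close> to \<open>(n n\<^sup>*) h n = n (n\<^sup>* h n)\<close> gives \<open>n n\<^sup>* h e = e n\<^sup>* h n\<close> for
  \<open>h \<in> M\<close>, and comparison with the case \<open>h = 1\<close> gives \<open>n\<^sup>* h n e = h e n\<^sup>* n\<close>. By the
  C*-identity the commutator of \<open>n e\<close> with \<open>h\<close> then vanishes, and maximality applies.\<close>

lemma normalizer_mult_expectation_mem:
  fixes M :: "'a::cstar_algebra set"
  assumes M: "maximal_abelian M" "1 \<in> M" and E: "faithful_conditional_expectation M E"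
    and n: "n \<in> normalizers M"
  shows "n * E n \<in> M"
proof -
  define e where "e = E n"
  have M_mult: "a * b \<in> M" and comm: "a * b = b * a" and M_star: "star a \<in> M"
    if "a \<in> M" "b \<in> M" for a b
    using M(1) that
    by (auto simp: maximal_abelian_def abelian_cstar_subalgebra_def cstar_subalgebra_def)
  have e: "e \<in> M"
    using E by (auto simp: e_def faithful_conditional_expectation_def)
  have E_mult: "E (m * a) = m * E a" "E (a * m) = E a * m" if "m \<in> M" for m a
    using E M(2) that unfolding faithful_conditional_expectation_def
    by (metis mult.left_neutral mult.right_neutral)+
  have nMn: "star n * h * n \<in> M" "n * h * star n \<in> M" if "h \<in> M" for h
    using n that by (auto simp: normalizers_def)
  have nn: "star n * n \<in> M" "n * star n \<in> M"
    using nMn[OF M(2)] by simp_all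
  have transport: "n * star n * h * e = e * (star n * h * n)" if h: "h \<in> M" for h
  proof -
    have "n * star n * h * e = E (n * star n * h * n)"
      unfolding e_def using M_mult[OF nn(2) h] by (simp add: E_mult)
    also have "\<dots> = E (n * (star n * h * n))"
      by (simp add: mult.assoc)
    also have "\<dots> = e * (star n * h * n)"
      unfolding e_def using nMn(1)[OF h] by (simp add: E_mult)
    finally show ?thesis .
  qed
  have fix_e: "star n * h * n * e = h * e * (star n * n)" if h: "h \<in> M" for h
  proof -
    have "star n * h * n * e = n * star n * h * e"
      using transport[OF h] comm[OF nMn(1)[OF h] e] by simp
    also have "\<dots> = h * (n * star n * 1 * e)"
      using comm[OF nn(2) h] by (simp add: mult.assoc)
    also have "\<dots> = h * e * (star n * n)"
      using transport[OF M(2)] by (simp add: mult.assoc)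
    finally show ?thesis .
  qed
  have vanish: "(n * h - h * n) * e = 0" if h: "h \<in> M" for h
  proof -
    define d where "d = (n * h - h * n) * e"
    define g where "g = star h"
    have g: "g \<in> M"
      using M_star[OF h h] by (simp add: g_def)
    \<comment> \<open>The four terms of the product all reduce to \<open>g h e n\<^sup>* n\<close>, with signs that cancel.\<close>
    have "star d * d = star e * (g * (star n * n) * h * e - g * (star n * h * n * e)
        - star n * g * n * h * e + star n * (g * h) * n * e)"
      unfolding d_def g_def by (simp add: star_mult star_diff algebra_simps)
    also have "g * (star n * n) * h * e = g * h * e * (star n * n)"
      using comm[OF nn(1) M_mult[OF h e]] by (simp add: mult.assoc)
    also have "g * (star n * h * n * e) = g * h * e * (star n * n)"
      unfolding fix_e[OF h] by (simp add: mult.assoc)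
    also have "star n * g * n * h * e = g * h * e * (star n * n)"
    proof -
      have "star n * g * n * h * e = star n * g * n * e * h"
        using comm[OF h e] by (simp add: mult.assoc)
      also have "\<dots> = g * (e * (star n * n) * h)"
        unfolding fix_e[OF g] by (simp add: mult.assoc)
      also have "e * (star n * n) * h = h * (e * (star n * n))"
        by (rule comm[OF M_mult[OF e nn(1)] h])
      finally show ?thesis
        by (simp add: mult.assoc)
    qed
    also have "star n * (g * h) * n * e = g * h * e * (star n * n)"
      by (rule fix_e[OF M_mult[OF g h]])
    finally have "star d * d = 0"
      by simp
    then show ?thesis
      unfolding d_def star_mult_self_eq_zero_iff .
  qed
  have "n * e \<in> M"
  proof (rule maximal_abelian_commutant[OF M(1)])
    fix h assume h: "h \<in> M"
    have "n * e * h = n * h * e"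
      using comm[OF e h] by (simp add: mult.assoc)
    also have "\<dots> = h * (n * e)"
      using vanish[OF h] by (simp add: algebra_simps)
    finally show "n * e * h = h * (n * e)" .
  qed
  then show ?thesis
    by (simp add: e_def)
qed


section \<open>Eigenvectors of the Cartan subalgebra\<close>

locale cartan_point =
  fixes M :: "'a::cstar_algebra set" and E :: "'a \<Rightarrow> 'a" and x0 :: "'a \<Rightarrow> complex"
    and \<pi> :: "'a \<Rightarrow> ('h::complex_hilbert_space \<Rightarrow>\<^sub>L 'h)" and \<Omega> :: 'h
  assumes cartan: "cartan_subalgebra M"
    and expectation: "faithful_conditional_expectation M E"
    and point: "x0 \<in> gelfand_space M"
    and trivial_isotropy: "\<not> nontrivial_isotropy M E x0"
    and gns: "gns_representation (\<lambda>a. x0 (E a)) \<pi> \<Omega>"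
begin

lemma maximal: "maximal_abelian M" and one_mem: "1 \<in> M"
  and hull_normalizers: "cstar_subalgebra hull (normalizers M) = UNIV"
  using cartan by (auto simp: cartan_subalgebra_def)

lemma subalgebra: "cstar_subalgebra M"
  using maximal by (simp add: maximal_abelian_def abelian_cstar_subalgebra_def)

lemma mult_mem: "a \<in> M \<Longrightarrow> b \<in> M \<Longrightarrow> a * b \<in> M"
  and star_mem: "a \<in> M \<Longrightarrow> star a \<in> M"
  using subalgebra by (auto simp: cstar_subalgebra_def)

lemma commute: "a \<in> M \<Longrightarrow> b \<in> M \<Longrightarrow> a * b = b * a"
  using maximal by (simp add: maximal_abelian_def abelian_cstar_subalgebra_def)

lemma expectation_mem: "E a \<in> M"
  and expectation_eq: "m \<in> M \<Longrightarrow> E m = m"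
  and norm_expectation_le: "norm (E a) \<le> norm a"
  using expectation by (auto simp: faithful_conditional_expectation_def)

lemma point_mult: "a \<in> M \<Longrightarrow> b \<in> M \<Longrightarrow> x0 (a * b) = x0 a * x0 b"
  using point by (simp add: gelfand_space_def)

lemma representation: "star_representation \<pi>"
  and cyclic: "closure (range (\<lambda>a. \<pi> a \<Omega>)) = UNIV"
  and state: "x0 (E a) = cinner \<Omega> (\<pi> a \<Omega>)"
  using gns by (simp_all add: gns_representation_def)

lemmas cinner_rep = star_representation_cinner[OF representation]
  and rep_mult = star_representation_mult[OF representation]

lemma rep_one: "\<pi> 1 \<xi> = \<xi>"
  using representation by (simp add: star_representation_def)

lemma rep_scaleC: "\<pi> a (c *\<^sub>C \<xi>) = c *\<^sub>C \<pi> a \<xi>"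
proof -
  have "\<pi> a \<in> bounded_ops"
    using representation unfolding star_representation_def by blast
  then show ?thesis
    by (simp add: bounded_ops_def complex_linear_on_def)
qed

lemma rep_add_left: "\<pi> (a + b) \<xi> = \<pi> a \<xi> + \<pi> b \<xi>"
  and rep_scaleC_left: "\<pi> (c *\<^sub>C a) \<xi> = c *\<^sub>C \<pi> a \<xi>"
  using representation
  by (simp_all add: star_representation_def complex_linear_on_def blinfun.add_left scaleC_blinfun.rep_eq)

lemma state_bounded: "cmod (cinner \<Omega> (\<pi> a \<Omega>)) \<le> 1 * norm a"
  using character_norm_le[OF subalgebra one_mem point expectation_mem[of a]] norm_expectation_le[of a]
  unfolding state[symmetric] by simp

lemmas rep_norm_le = cyclic_representation_norm_le[OF representation cyclic state_bounded]

lemma bounded_linear_rep: "bounded_linear (\<lambda>a. \<pi> a \<xi>)"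
  by (rule bounded_linear_intro[where K = "norm \<xi>"])
    (use rep_norm_le in \<open>simp_all add: rep_add_left rep_scaleC_left flip: scaleC_of_real\<close>)

lemma state_mem: "m \<in> M \<Longrightarrow> x0 m = cinner \<Omega> (\<pi> m \<Omega>)"
  using state[of m] by (simp add: expectation_eq)

lemma one_normalizer: "1 \<in> normalizers M"
  by (simp add: normalizers_def)

lemma normalizer_mem:
  assumes "n \<in> normalizers M"
  shows "h \<in> M \<Longrightarrow> star n * h * n \<in> M" and "h \<in> M \<Longrightarrow> n * h * star n \<in> M"
    and "star n * n \<in> M" and "n * star n \<in> M"
  using assms one_mem unfolding normalizers_def by force+

lemma cinner_orbit: "cinner (\<pi> n \<Omega>) (\<pi> a (\<pi> m \<Omega>)) = cinner \<Omega> (\<pi> (star n * a * m) \<Omega>)"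
  by (simp add: cinner_rep rep_mult)

text \<open>The value at \<open>h\<close> of the point \<open>\<alpha>\<^sub>n(x\<^sub>0)\<close>, for a normalizer \<open>n\<close> whose domain contains
  \<open>x\<^sub>0\<close>. Otherwise \<open>\<pi>(n)\<Omega> = 0\<close>, and the value is \<open>0\<close>.\<close>

definition orbit_point :: "'a \<Rightarrow> 'a \<Rightarrow> complex" where
  "orbit_point n h = x0 (star n * h * n) / x0 (star n * n)"

lemma point_norm_eq:
  assumes "n \<in> normalizers M"
  shows "x0 (star n * n) = complex_of_real ((norm (\<pi> n \<Omega>))\<^sup>2)"
  using normalizer_mem(3)[OF assms] by (simp add: state_mem rep_mult cinner_self flip: cinner_rep)

text \<open>By the multiplicativity of \<open>x\<^sub>0\<close> and \<open>n\<^sup>* h\<^sup>* h n n\<^sup>* n = (n\<^sup>* h\<^sup>* n) (n\<^sup>* h n)\<close>, the vectors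
  \<open>\<pi>(n)\<Omega>\<close> and \<open>\<pi>(h)\<pi>(n)\<Omega>\<close> give equality in the Cauchy--Schwarz inequality.\<close>

lemma orbit_eigenvector:
  assumes n: "n \<in> normalizers M" and h: "h \<in> M"
  shows "\<pi> h (\<pi> n \<Omega>) = orbit_point n h *\<^sub>C \<pi> n \<Omega>"
proof (cases "\<pi> n \<Omega> = 0")
  case False
  define c where "c = orbit_point n h"
  define N where "N = x0 (star n * n)"
  have "N \<noteq> 0"
    using False by (simp add: N_def point_norm_eq[OF n])
  have N: "cinner (\<pi> n \<Omega>) (\<pi> n \<Omega>) = N"
    using point_norm_eq[OF n] by (simp add: N_def cinner_self)
  have 1: "x0 (star n * h * n) = c * N"
    using \<open>N \<noteq> 0\<close> by (simp add: c_def N_def orbit_point_def)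
  have "x0 (star n * star h * n) = cnj (x0 (star n * h * n))"
    using normalizer_mem(1)[OF n h] normalizer_mem(1)[OF n star_mem[OF h]]
    by (simp add: state_mem rep_mult star_mult flip: cinner_rep)
      (metis cinner_commute cinner_rep star_star)
  also have "\<dots> = cnj c * N"
    using 1 by (simp add: N_def point_norm_eq[OF n])
  finally have 2: "x0 (star n * star h * n) = cnj c * N" .
  have "star n * (star h * h) * n * (star n * n) = star n * star h * (h * (n * star n)) * n"
    by (simp add: mult.assoc)
  also have "\<dots> = (star n * star h * n) * (star n * h * n)"
    by (subst commute[OF h normalizer_mem(4)[OF n]]) (simp add: mult.assoc)
  finally have "x0 (star n * (star h * h) * n) * N = x0 (star n * star h * n) * x0 (star n * h * n)"
    using point_mult[OF normalizer_mem(1)[OF n mult_mem[OF star_mem[OF h] h]] normalizer_mem(3)[OF n]]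
      point_mult[OF normalizer_mem(1)[OF n star_mem[OF h]] normalizer_mem(1)[OF n h]]
    by (simp add: N_def)
  then have 3: "x0 (star n * (star h * h) * n) = cnj c * c * N"
    unfolding 1 2 using \<open>N \<noteq> 0\<close> by simp
  have "\<pi> h (\<pi> n \<Omega>) = c *\<^sub>C \<pi> n \<Omega>"
  proof (rule eq_scaleC_if_cinner)
    show "cinner (\<pi> n \<Omega>) (\<pi> h (\<pi> n \<Omega>)) = c * cinner (\<pi> n \<Omega>) (\<pi> n \<Omega>)"
      unfolding cinner_orbit N using 1 normalizer_mem(1)[OF n h] by (simp add: state_mem)
    have "cinner (\<pi> h (\<pi> n \<Omega>)) (\<pi> h (\<pi> n \<Omega>)) = cinner (\<pi> n \<Omega>) (\<pi> (star h * h) (\<pi> n \<Omega>))"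
      by (simp add: cinner_rep rep_mult)
    then show "cinner (\<pi> h (\<pi> n \<Omega>)) (\<pi> h (\<pi> n \<Omega>)) = cnj c * c * cinner (\<pi> n \<Omega>) (\<pi> n \<Omega>)"
      unfolding cinner_orbit N using 3 normalizer_mem(1)[OF n mult_mem[OF star_mem[OF h] h]]
      by (simp add: state_mem)
  qed
  then show ?thesis
    by (simp add: c_def)
qed simp

lemma point_one: "x0 1 = 1"
proof -
  obtain a where "a \<in> M" "x0 a \<noteq> 0"
    using point by (auto simp: gelfand_space_def)
  then show ?thesis
    using point_mult[OF \<open>a \<in> M\<close> one_mem] by simp
qed

lemma cyclic_eigenvector: "h \<in> M \<Longrightarrow> \<pi> h \<Omega> = x0 h *\<^sub>C \<Omega>"
  using orbit_eigenvector[OF one_normalizer, of h] by (simp add: orbit_point_def rep_one point_one)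

text \<open>Trivial isotropy enters here: \<open>e = E n\<close> does not vanish at \<open>x\<^sub>0\<close>, and both \<open>e\<close> and
  \<open>n e\<close> belong to \<open>M\<close> and hence act on \<open>\<Omega>\<close> by scalars.\<close>

lemma stabilizer_eigenvector:
  assumes n: "n \<in> normalizers M" and "\<pi> n \<Omega> \<noteq> 0"
    and fixed: "\<And>h. h \<in> M \<Longrightarrow> x0 (star n * h * n) = x0 h * x0 (star n * n)"
  obtains c where "\<pi> n \<Omega> = c *\<^sub>C \<Omega>"
proof -
  have "0 < x0 (star n * n)" "x0 (star n * n) \<noteq> 0"
    using \<open>\<pi> n \<Omega> \<noteq> 0\<close> by (simp_all add: point_norm_eq[OF n] less_complex_def)
  have "alpha M n x0 = x0"
    unfolding alpha_def
  proof (rule the_equality)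
    show "x0 \<in> gelfand_space M \<and> (\<forall>h\<in>M. x0 (star n * h * n) = x0 h * x0 (star n * n))"
      using point fixed by simp
    fix y assume y: "y \<in> gelfand_space M \<and> (\<forall>h\<in>M. x0 (star n * h * n) = y h * x0 (star n * n))"
    show "y = x0"
    proof (rule extensionalityI)
      show "y \<in> extensional M" "x0 \<in> extensional M"
        using y point by (simp_all add: gelfand_space_def)
      show "y h = x0 h" if "h \<in> M" for h
        using y fixed[OF that] that \<open>x0 (star n * n) \<noteq> 0\<close> by auto
    qed
  qed
  then have "x0 (E n) \<noteq> 0"
    using trivial_isotropy n point \<open>0 < x0 (star n * n)\<close>
    by (auto simp: nontrivial_isotropy_def alpha_dom_def)
  have "x0 (E n) *\<^sub>C \<pi> n \<Omega> = \<pi> (n * E n) \<Omega>"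
    by (simp add: rep_mult cyclic_eigenvector[OF expectation_mem] rep_scaleC)
  also have "\<dots> = x0 (n * E n) *\<^sub>C \<Omega>"
    using normalizer_mult_expectation_mem[OF maximal one_mem expectation n]
    by (rule cyclic_eigenvector)
  finally have "(1 / x0 (E n)) *\<^sub>C x0 (E n) *\<^sub>C \<pi> n \<Omega> = (1 / x0 (E n)) *\<^sub>C x0 (n * E n) *\<^sub>C \<Omega>"
    by simp
  then have "\<pi> n \<Omega> = (x0 (n * E n) / x0 (E n)) *\<^sub>C \<Omega>"
    using \<open>x0 (E n) \<noteq> 0\<close> by (simp add: scaleC_scaleC)
  then show ?thesis
    by (rule that)
qed

text \<open>If \<open>\<alpha>\<^sub>n(x\<^sub>0) = \<alpha>\<^sub>m(x\<^sub>0)\<close>, then the normalizer \<open>m\<^sup>* n\<close> fixes \<open>x\<^sub>0\<close>, so \<open>\<pi>(m\<^sup>* n)\<Omega>\<close> is a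
  multiple of \<open>\<Omega>\<close>. Applying \<open>\<pi>(m)\<close> gives the claim, since \<open>m m\<^sup>*\<close> acts on \<open>\<pi>(n)\<Omega>\<close> by a
  non-zero scalar.\<close>

lemma orbit_vectors_proportional:
  assumes n: "n \<in> normalizers M" "\<pi> n \<Omega> \<noteq> 0" and m: "m \<in> normalizers M" "\<pi> m \<Omega> \<noteq> 0"
    and same: "\<And>h. h \<in> M \<Longrightarrow> orbit_point m h = orbit_point n h"
  obtains c where "\<pi> n \<Omega> = c *\<^sub>C \<pi> m \<Omega>"
proof -
  define k where "k = star m * n"
  define N where "N = x0 (star n * n)"
  define L where "L = x0 (star m * m)"
  have "N \<noteq> 0" "L \<noteq> 0"
    using n m by (simp_all add: N_def L_def point_norm_eq)
  have transport: "orbit_point n (m * h * star m) = L * x0 h" if h: "h \<in> M" for h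
  proof -
    have "x0 (star m * (m * h * star m) * m) = x0 ((star m * m) * (h * (star m * m)))"
      by (simp add: mult.assoc)
    also have "\<dots> = L * (x0 h * L)"
      using h normalizer_mem(3)[OF m(1)] by (simp add: point_mult mult_mem L_def)
    finally have "orbit_point m (m * h * star m) = L * x0 h"
      using \<open>L \<noteq> 0\<close> by (simp add: orbit_point_def flip: L_def)
    then show ?thesis
      using same normalizer_mem(2)[OF m(1) h] by simp
  qed
  have k_point: "x0 (star k * h * k) = L * N * x0 h" if h: "h \<in> M" for h
  proof -
    have "star k * h * k = star n * (m * h * star m) * n"
      by (simp add: k_def star_mult star_star mult.assoc)
    then have "x0 (star k * h * k) = orbit_point n (m * h * star m) * N"
      using \<open>N \<noteq> 0\<close> by (simp add: orbit_point_def N_def)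
    then show ?thesis
      by (simp add: transport[OF h])
  qed
  have kk: "x0 (star k * k) = L * N"
    using k_point[OF one_mem] by (simp add: point_one)
  have "k \<noteq> 0"
  proof
    assume "k = 0"
    then have "x0 0 = L * N"
      using kk by simp
    moreover have "x0 0 = 0"
      using state[of 0] expectation_eq[of 0] subalgebra representation
        complex_linear_on_diff[of \<pi> 0 0]
      by (simp add: star_representation_def cstar_subalgebra_def complex_subspace_def)
    ultimately show False
      using \<open>N \<noteq> 0\<close> \<open>L \<noteq> 0\<close> by simp
  qed
  then have k: "k \<in> normalizers M"
    unfolding k_def by (intro normalizers_mult normalizers_star n m)
  have "\<pi> k \<Omega> \<noteq> 0"
    using point_norm_eq[OF k] kk \<open>N \<noteq> 0\<close> \<open>L \<noteq> 0\<close> by auto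
  obtain c where c: "\<pi> k \<Omega> = c *\<^sub>C \<Omega>"
    using stabilizer_eigenvector[OF k \<open>\<pi> k \<Omega> \<noteq> 0\<close>] k_point kk by (metis mult.commute)
  have "L *\<^sub>C \<pi> n \<Omega> = \<pi> (m * star m) (\<pi> n \<Omega>)"
    using orbit_eigenvector[OF n(1) normalizer_mem(4)[OF m(1)]] transport[OF one_mem]
    by (simp add: point_one)
  also have "\<dots> = c *\<^sub>C \<pi> m \<Omega>"
    using c by (simp add: k_def rep_mult rep_scaleC)
  finally have "(1 / L) *\<^sub>C L *\<^sub>C \<pi> n \<Omega> = (1 / L) *\<^sub>C c *\<^sub>C \<pi> m \<Omega>"
    by simp
  then have "\<pi> n \<Omega> = (c / L) *\<^sub>C \<pi> m \<Omega>"
    using \<open>L \<noteq> 0\<close> by (simp add: scaleC_scaleC)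
  then show ?thesis
    by (rule that)
qed

text \<open>The orthogonal complement of the vectors \<open>\<pi>(n)\<Omega>\<close> is invariant under normalizers, hence
  under the C*-algebra that they generate; since \<open>\<Omega>\<close> is cyclic and orthogonal to it, it is zero.\<close>

lemma orbit_vectors_total:
  assumes "\<And>n. n \<in> normalizers M \<Longrightarrow> cinner (\<pi> n \<Omega>) \<xi> = 0"
  shows "\<xi> = 0"
proof -
  define K where "K = {\<eta>. \<forall>n\<in>normalizers M. cinner (\<pi> n \<Omega>) \<eta> = 0}"
  define C where "C = {a. \<forall>\<eta>\<in>K. \<pi> a \<eta> \<in> K \<and> \<pi> (star a) \<eta> \<in> K}"
  have "\<pi> n \<eta> \<in> K" if n: "n \<in> normalizers M" and "\<eta> \<in> K" for n \<eta>
    unfolding K_def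
  proof safe
    fix m assume m: "m \<in> normalizers M"
    have "cinner (\<pi> m \<Omega>) (\<pi> n \<eta>) = cinner (\<pi> (star n * m) \<Omega>) \<eta>"
      by (simp add: cinner_rep rep_mult star_mult star_star)
    also have "\<dots> = 0"
    proof (cases "star n * m = 0")
      case True
      then show ?thesis
        using rep_norm_le[of 0 \<Omega>] by simp
    next
      case False
      then have "star n * m \<in> normalizers M"
        by (intro normalizers_mult normalizers_star n m)
      with \<open>\<eta> \<in> K\<close> show ?thesis
        by (simp add: K_def)
    qed
    finally show "cinner (\<pi> m \<Omega>) (\<pi> n \<eta>) = 0" .
  qed
  then have "normalizers M \<subseteq> C"
    unfolding C_def using normalizers_star by blast
  have "cstar_subalgebra C"
    unfolding cstar_subalgebra_def complex_subspace_def
  proof (intro conjI ballI allI)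
    show "0 \<in> C"
      using rep_norm_le[of 0] by (simp add: C_def K_def)
    show "a + b \<in> C" "a * b \<in> C" if "a \<in> C" "b \<in> C" for a b
      using that
      by (simp_all add: C_def K_def star_add star_mult rep_add_left rep_mult cinner_add_right)
    show "c *\<^sub>C a \<in> C" "star a \<in> C" if "a \<in> C" for a c
      using that by (simp_all add: C_def K_def star_scaleC rep_scaleC_left cinner_scaleC_right star_star)
    have star: "bounded_linear (star :: 'a \<Rightarrow> 'a)"
      by (rule bounded_linear_intro[where K = 1]) (simp_all add: star_add star_scaleR norm_star)
    note bounded = bounded_linear_rep bounded_linear_compose[OF bounded_linear_rep star]
    have "closed {a. cinner (\<pi> n \<Omega>) (\<pi> a \<eta>) = 0}" "closed {a. cinner (\<pi> n \<Omega>) (\<pi> (star a) \<eta>) = 0}" for n \<eta>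
      by (intro closed_Collect_eq continuous_on_const
          linear_continuous_on bounded_linear_compose[OF bounded_linear_cinner_right bounded(1)]
          bounded_linear_compose[OF bounded_linear_cinner_right bounded(2)])+
    then have "closed (\<Inter>\<eta>\<in>K. \<Inter>n\<in>normalizers M.
        {a. cinner (\<pi> n \<Omega>) (\<pi> a \<eta>) = 0} \<inter> {a. cinner (\<pi> n \<Omega>) (\<pi> (star a) \<eta>) = 0})"
      by (intro closed_INT ballI closed_Int)
    also have "\<dots> = C"
      by (auto simp: C_def K_def)
    finally show "closed C" .
  qed
  then have "C = UNIV"
    using hull_minimal[OF \<open>normalizers M \<subseteq> C\<close>, of cstar_subalgebra] hull_normalizers by blast
  have "\<xi> \<in> K"
    using assms by (simp add: K_def)
  have "cinner \<xi> (\<pi> a \<Omega>) = 0" for a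
  proof -
    have "\<pi> (star a) \<xi> \<in> K"
      using \<open>C = UNIV\<close> \<open>\<xi> \<in> K\<close> unfolding C_def by blast
    then have "cinner \<Omega> (\<pi> (star a) \<xi>) = 0"
      using one_normalizer by (auto simp: K_def rep_one dest: bspec[of _ _ 1])
    then have "cinner (\<pi> (star a) \<xi>) \<Omega> = 0"
      by (metis cinner_commute complex_cnj_zero)
    then show ?thesis
      by (simp add: cinner_rep star_star)
  qed
  moreover have "closed {\<eta>. cinner \<xi> \<eta> = 0}"
    by (intro closed_Collect_eq continuous_on_const linear_continuous_on bounded_linear_cinner_right)
  ultimately have "closure (range (\<lambda>a. \<pi> a \<Omega>)) \<subseteq> {\<eta>. cinner \<xi> \<eta> = 0}"
    by (intro closure_minimal) auto
  then have "cinner \<xi> \<xi> = 0"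
    using cyclic by blast
  then show ?thesis
    by simp
qed


section \<open>Invariant subspaces\<close>

lemma cnj_orbit_point_star:
  assumes n: "n \<in> normalizers M" "\<pi> n \<Omega> \<noteq> 0" and h: "h \<in> M"
  shows "cnj (orbit_point n (star h)) = orbit_point n h"
proof -
  have "cinner (\<pi> (star h) (\<pi> n \<Omega>)) (\<pi> n \<Omega>) = cinner (\<pi> n \<Omega>) (\<pi> h (\<pi> n \<Omega>))"
    by (simp add: cinner_rep star_star)
  then show ?thesis
    using n(2) unfolding orbit_eigenvector[OF n(1) h] orbit_eigenvector[OF n(1) star_mem[OF h]]
    by (simp add: cinner_simps)
qed

text \<open>Joint eigenvectors of \<open>M\<close> for different points are orthogonal, and the orbit vectors are
  total, so each point of the orbit has a one-dimensional joint eigenspace.\<close>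

lemma joint_eigenvector_proportional:
  assumes n: "n \<in> normalizers M" "\<pi> n \<Omega> \<noteq> 0"
    and \<xi>: "\<And>h. h \<in> M \<Longrightarrow> \<pi> h \<xi> = orbit_point n h *\<^sub>C \<xi>"
  obtains c where "\<xi> = c *\<^sub>C \<pi> n \<Omega>"
proof -
  define c where "c = cinner (\<pi> n \<Omega>) \<xi> / cinner (\<pi> n \<Omega>) (\<pi> n \<Omega>)"
  define \<eta> where "\<eta> = \<xi> - c *\<^sub>C \<pi> n \<Omega>"
  have n_\<eta>: "cinner (\<pi> n \<Omega>) \<eta> = 0"
    using n(2) by (simp add: \<eta>_def c_def cinner_simps)
  have eigen: "\<pi> h \<eta> = orbit_point n h *\<^sub>C \<eta>" if h: "h \<in> M" for h
  proof -
    have "\<pi> h \<eta> = orbit_point n h *\<^sub>C \<xi> - orbit_point n h *\<^sub>C c *\<^sub>C \<pi> n \<Omega>"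
      by (simp add: \<eta>_def blinfun.diff_right rep_scaleC \<xi>[OF h] orbit_eigenvector[OF n(1) h]
          scaleC_scaleC mult.commute)
    also have "\<dots> = orbit_point n h *\<^sub>C \<eta>"
      by (simp add: \<eta>_def scaleC_diff_right)
    finally show ?thesis .
  qed
  have "cinner (\<pi> m \<Omega>) \<eta> = 0" if m: "m \<in> normalizers M" for m
  proof (cases "\<pi> m \<Omega> = 0")
    case False
    show ?thesis
    proof (cases "\<forall>h\<in>M. orbit_point n h = orbit_point m h")
      case True
      then obtain b where "\<pi> m \<Omega> = b *\<^sub>C \<pi> n \<Omega>"
        using orbit_vectors_proportional[OF m False n] by metis
      then show ?thesis
        by (simp add: cinner_scaleC_left n_\<eta>)
    next
      case distinct: False
      then obtain h where h: "h \<in> M" and "orbit_point n h \<noteq> orbit_point m h"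
        by blast
      have "orbit_point m h * cinner (\<pi> m \<Omega>) \<eta> = cinner (\<pi> (star h) (\<pi> m \<Omega>)) \<eta>"
        by (simp add: orbit_eigenvector[OF m star_mem[OF h]] cinner_scaleC_left
            cnj_orbit_point_star[OF m False h])
      also have "\<dots> = orbit_point n h * cinner (\<pi> m \<Omega>) \<eta>"
        by (simp only: cinner_rep star_star eigen[OF h] cinner_scaleC_right rep_scaleC)
      finally show ?thesis
        using \<open>orbit_point n h \<noteq> orbit_point m h\<close> by simp
    qed
  qed simp
  then have "\<eta> = 0"
    by (rule orbit_vectors_total)
  then show ?thesis
    using that[of c] by (simp add: \<eta>_def)
qed

text \<open>The projection onto a closed \<open>M\<close>-invariant subspace commutes with \<open>M\<close>, so it maps \<open>\<pi>(n)\<Omega>\<close> into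
  the joint eigenspace of \<open>\<pi>(n)\<Omega>\<close>, that is, to a multiple of itself.\<close>

lemma orbit_vector_mem_or_orthogonal:
  assumes V: "complex_subspace V" "closed V" "\<And>h v. h \<in> M \<Longrightarrow> v \<in> V \<Longrightarrow> \<pi> h v \<in> V"
    and n: "n \<in> normalizers M"
  shows "\<pi> n \<Omega> \<in> V \<or> (\<forall>v\<in>V. cinner (\<pi> n \<Omega>) v = 0)"
proof (cases "\<pi> n \<Omega> = 0")
  case False
  obtain p where p: "p \<in> V" and orth: "\<And>v. v \<in> V \<Longrightarrow> cinner v (\<pi> n \<Omega> - p) = 0"
    using orthogonal_projection_exists[OF V(1,2)] by blast
  have "\<pi> h p = orbit_point n h *\<^sub>C p" if h: "h \<in> M" for h
  proof -
    define d where "d = \<pi> h p - orbit_point n h *\<^sub>C p"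
    have "d \<in> V"
      unfolding d_def using V p h by (intro complex_subspace_diff) (auto simp: complex_subspace_def)
    have "d = orbit_point n h *\<^sub>C (\<pi> n \<Omega> - p) - \<pi> h (\<pi> n \<Omega> - p)"
      by (simp add: d_def scaleC_diff_right blinfun.diff_right orbit_eigenvector[OF n h])
    then have "cinner d d = orbit_point n h * cinner d (\<pi> n \<Omega> - p) - cinner (\<pi> (star h) d) (\<pi> n \<Omega> - p)"
      by (metis cinner_diff_right cinner_scaleC_right cinner_rep star_star)
    also have "\<dots> = 0"
      using orth \<open>d \<in> V\<close> V(3)[OF star_mem[OF h] \<open>d \<in> V\<close>] by simp
    finally show ?thesis
      by (simp add: d_def)
  qed
  then obtain c where c: "p = c *\<^sub>C \<pi> n \<Omega>"
    using joint_eigenvector_proportional[OF n False] by blast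
  show ?thesis
  proof (cases "c = 0")
    case True
    then have "cinner v (\<pi> n \<Omega>) = 0" if "v \<in> V" for v
      using orth[OF that] c by simp
    then show ?thesis
      by (metis cinner_commute complex_cnj_zero)
  next
    case False
    then have "(1 / c) *\<^sub>C p = \<pi> n \<Omega>"
      by (simp add: c scaleC_scaleC)
    then show ?thesis
      using V(1) p by (metis complex_subspace_def)
  qed
qed (use V(1) in \<open>simp add: complex_subspace_def\<close>)

text \<open>The component of a vector of \<open>V\<close> orthogonal to \<open>W\<close> is orthogonal to every orbit vector:
  those in \<open>W\<close> by construction, and the others because they are orthogonal to \<open>W\<close> and, not being
  in \<open>V\<close> either, also to \<open>V\<close>.\<close>

lemma subset_if_orbit_vectors_subset:
  assumes V: "complex_subspace V" "closed V" "\<And>h v. h \<in> M \<Longrightarrow> v \<in> V \<Longrightarrow> \<pi> h v \<in> V"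
    and W: "complex_subspace W" "closed W"
    and sub: "\<And>n. n \<in> normalizers M \<Longrightarrow> \<pi> n \<Omega> \<in> V \<Longrightarrow> \<pi> n \<Omega> \<in> W"
    and W_orth: "\<And>n. n \<in> normalizers M \<Longrightarrow> \<pi> n \<Omega> \<in> W \<or> (\<forall>w\<in>W. cinner (\<pi> n \<Omega>) w = 0)"
  shows "V \<subseteq> W"
proof
  fix v assume "v \<in> V"
  obtain p where p: "p \<in> W" and orth: "\<And>w. w \<in> W \<Longrightarrow> cinner w (v - p) = 0"
    using orthogonal_projection_exists[OF W] by blast
  have "v - p = 0"
  proof (rule orbit_vectors_total)
    fix n assume n: "n \<in> normalizers M"
    consider "\<pi> n \<Omega> \<in> W" | "\<forall>w\<in>W. cinner (\<pi> n \<Omega>) w = 0" "\<forall>v\<in>V. cinner (\<pi> n \<Omega>) v = 0"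
      using orbit_vector_mem_or_orthogonal[OF V n] sub[OF n] W_orth[OF n] by blast
    then show "cinner (\<pi> n \<Omega>) (v - p) = 0"
      using orth p \<open>v \<in> V\<close> by cases (simp_all add: cinner_diff_right)
  qed
  with p show "v \<in> W"
    by simp
qed

text \<open>If neither of \<open>V\<close> and \<open>W\<close> contains the other, then some \<open>\<pi>(n)\<Omega> \<in> V\<close> is orthogonal to \<open>W\<close>
  and some \<open>\<pi>(m)\<Omega> \<in> W\<close> is orthogonal to \<open>V\<close>. The matrix coefficient of these two vectors then
  vanishes on \<open>B\<close> by invariance of \<open>V\<close>, and on the adjoint of \<open>B\<close> by invariance of \<open>W\<close>. By the
  Dirichlet property it vanishes everywhere, but at \<open>m n\<^sup>*\<close> it does not.\<close>

theorem invariant_subspaces_comparable: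
  assumes "dirichlet B" and "M \<subseteq> B"
    and V: "V \<in> invariant_subspaces (\<pi> ` B)" and W: "W \<in> invariant_subspaces (\<pi> ` B)"
  shows "V \<subseteq> W \<or> W \<subseteq> V"
proof (rule ccontr)
  assume "\<not> (V \<subseteq> W \<or> W \<subseteq> V)"
  then have not_sub: "\<not> V \<subseteq> W" "\<not> W \<subseteq> V"
    by simp_all
  have V': "complex_subspace V" "closed V" "\<And>h v. h \<in> M \<Longrightarrow> v \<in> V \<Longrightarrow> \<pi> h v \<in> V"
    and V_inv: "\<And>b v. b \<in> B \<Longrightarrow> v \<in> V \<Longrightarrow> \<pi> b v \<in> V"
    and W': "complex_subspace W" "closed W" "\<And>h v. h \<in> M \<Longrightarrow> v \<in> W \<Longrightarrow> \<pi> h v \<in> W"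
    and W_inv: "\<And>b v. b \<in> B \<Longrightarrow> v \<in> W \<Longrightarrow> \<pi> b v \<in> W"
    using V W \<open>M \<subseteq> B\<close> by (auto simp: invariant_subspaces_def)
  obtain n where n: "n \<in> normalizers M" "\<pi> n \<Omega> \<in> V" "\<pi> n \<Omega> \<notin> W"
    using subset_if_orbit_vectors_subset[OF V' W'(1,2)] orbit_vector_mem_or_orthogonal[OF W'] not_sub(1)
    by blast
  obtain m where m: "m \<in> normalizers M" "\<pi> m \<Omega> \<in> W" "\<pi> m \<Omega> \<notin> V"
    using subset_if_orbit_vectors_subset[OF W' V'(1,2)] orbit_vector_mem_or_orthogonal[OF V'] not_sub(2)
    by blast
  have n_orth: "\<forall>w\<in>W. cinner (\<pi> n \<Omega>) w = 0" and m_orth: "\<forall>v\<in>V. cinner (\<pi> m \<Omega>) v = 0"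
    using orbit_vector_mem_or_orthogonal[OF W' n(1)] orbit_vector_mem_or_orthogonal[OF V' m(1)] n m
    by blast+
  define Z where "Z = {a. cinner (\<pi> m \<Omega>) (\<pi> a (\<pi> n \<Omega>)) = 0}"
  have "a + star b \<in> Z" if "a \<in> B" "b \<in> B" for a b
  proof -
    have "cinner (\<pi> m \<Omega>) (\<pi> a (\<pi> n \<Omega>)) = 0"
      using m_orth V_inv[OF that(1) n(2)] by blast
    moreover have "cinner (\<pi> n \<Omega>) (\<pi> b (\<pi> m \<Omega>)) = 0"
      using n_orth W_inv[OF that(2) m(2)] by blast
    then have "cinner (\<pi> m \<Omega>) (\<pi> (star b) (\<pi> n \<Omega>)) = 0"
      by (metis cinner_rep cinner_commute complex_cnj_zero)
    ultimately show ?thesis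
      by (simp add: Z_def rep_add_left cinner_add_right)
  qed
  moreover have "closed Z"
    unfolding Z_def
    by (intro closed_Collect_eq continuous_on_const linear_continuous_on
        bounded_linear_compose[OF bounded_linear_cinner_right bounded_linear_rep])
  ultimately have "closure {a + star b | a b. a \<in> B \<and> b \<in> B} \<subseteq> Z"
    by (intro closure_minimal) auto
  then have "m * star n \<in> Z"
    using \<open>dirichlet B\<close> unfolding dirichlet_def by blast
  moreover have "\<pi> (m * star n) (\<pi> n \<Omega>) = x0 (star n * n) *\<^sub>C \<pi> m \<Omega>"
    using cyclic_eigenvector[OF normalizer_mem(3)[OF n(1)]] by (simp add: rep_mult rep_scaleC)
  ultimately have "x0 (star n * n) * cinner (\<pi> m \<Omega>) (\<pi> m \<Omega>) = 0"
    by (simp add: Z_def cinner_scaleC_right)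
  moreover have "\<pi> n \<Omega> \<noteq> 0" "\<pi> m \<Omega> \<noteq> 0"
    using n(3) m(3) V'(1) W'(1) by (auto simp: complex_subspace_def)
  ultimately show False
    by (simp add: point_norm_eq[OF n(1)])
qed

end

text \<open>Complete isometry of \<open>j\<close> identifies the matrix norms of \<open>A\<close> with those that \<open>j ` A\<close>
  inherits from the C*-algebra, so complete contractivity and comparability of invariant subspaces
  can both be taken from the representation of the latter.\<close>

theorem theorem1:
  fixes A M :: "('k::complex_hilbert_space \<Rightarrow>\<^sub>L 'k) set"
    and j :: "('k \<Rightarrow>\<^sub>L 'k) \<Rightarrow> 'a::cstar_algebra"
    and E :: "'a \<Rightarrow> 'a"
    and x0 :: "'a \<Rightarrow> complex"
    and \<pi>0 :: "'a \<Rightarrow> ('h::complex_hilbert_space \<Rightarrow>\<^sub>L 'h)"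
    and \<Omega> :: 'h
  assumes "unital_operator_algebra A"
    and "cstar_cover A j"
    and "dirichlet (j ` A)"
    and "abelian_star_subalgebra_of A M"
    and "cartan_subalgebra (j ` M)"
    and "faithful_conditional_expectation (j ` M) E"
    and "x0 \<in> gelfand_space (j ` M)"
    and "\<not> nontrivial_isotropy (j ` M) E x0"
    and "gns_representation (\<lambda>a. x0 (E a)) \<pi>0 \<Omega>"
  shows "nest_representation A (\<lambda>a. \<pi>0 (j a))"
proof -
  interpret cartan_point "j ` M" E x0 \<pi>0 \<Omega>
    using assms by unfold_locales
  have "j ` M \<subseteq> j ` A"
    using \<open>abelian_star_subalgebra_of A M\<close> by (auto simp: abelian_star_subalgebra_of_def)
  have j: "complex_linear_on A j" "\<And>S T. S \<in> A \<Longrightarrow> T \<in> A \<Longrightarrow> j (S o\<^sub>L T) = j S * j T"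
    and j_norm: "\<And>n T. (\<forall>p<n. \<forall>q<n. T p q \<in> A) \<Longrightarrow>
        cstar_matrix_norm n (\<lambda>p q. j (T p q)) = op_matrix_norm n T"
    using \<open>cstar_cover A j\<close> by (auto simp: cstar_cover_def)
  have \<pi>0: "range \<pi>0 \<subseteq> bounded_ops" "complex_linear_on UNIV \<pi>0" "\<And>a b. \<pi>0 (a * b) = \<pi>0 a o\<^sub>L \<pi>0 b"
    using representation by (auto simp: star_representation_def)
  have "representation A (\<lambda>a. \<pi>0 (j a))"
    unfolding representation_def
  proof (intro conjI ballI allI impI)
    show "(\<lambda>a. \<pi>0 (j a)) ` A \<subseteq> bounded_ops"
      using \<pi>0(1) by blast
    show "complex_linear_on A (\<lambda>a. \<pi>0 (j a))"
      using \<pi>0(2) j(1) by (simp add: complex_linear_on_def)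
    show "\<pi>0 (j (S o\<^sub>L T)) = \<pi>0 (j S) o\<^sub>L \<pi>0 (j T)" if "S \<in> A" "T \<in> A" for S T
      using that by (simp add: j(2) \<pi>0(3))
    show "op_matrix_norm n (\<lambda>p q. \<pi>0 (j (T p q))) \<le> op_matrix_norm n T"
      if "\<forall>p<n. \<forall>q<n. T p q \<in> A" for n T
      using cyclic_representation_completely_contractive[OF representation cyclic state_bounded,
          of n "\<lambda>p q. j (T p q)"]
      unfolding j_norm[OF that] .
  qed
  moreover have "V \<subseteq> W \<or> W \<subseteq> V"
    if "V \<in> invariant_subspaces ((\<lambda>a. \<pi>0 (j a)) ` A)" "W \<in> invariant_subspaces ((\<lambda>a. \<pi>0 (j a)) ` A)"
    for V W
    using that \<open>dirichlet (j ` A)\<close> \<open>j ` M \<subseteq> j ` A\<close> invariant_subspaces_comparable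
    by (simp add: image_image[symmetric, of \<pi>0 j])
  ultimately show ?thesis
    unfolding nest_representation_def by blast
qed

end
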